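(* Let $(X,G)$ be a minimal topological dynamical system and let $\overleftarrow{G}=\lim_{\leftarrow n}(G/\Gamma_n,\pi_n)$ be a $G$-subodometer with $\bigcap_{i\ge 0}\Gamma_i=\{e\}$. There exists an almost 1-1 factor map $\pi$ of $(X,G)$ onto $(\overleftarrow{G},G)$ with $|\pi^{-1}(\mathbf{e})|=1$ if and only if $(X,G)$ is conjugate to $(\Omega_G(f),G)$ for some semicocycle $f$ on $\overleftarrow{G}$ (with values in some compact metric space $K$) that is invariant under no rotation.
   Context: $G$ is a discrete finitely generated group with neutral element $e$, and $G$ is residually finite (there is a decreasing sequence of finite-index subgroups with trivial intersection). A topological dynamical system $(X,G)$ is a compact metric space with an action of $G$ by homeomorphisms. It is minimal if every $G$-orbit is dense. A factor map is a continuous surjection commuting with the actions; it is an almost 1-1 factor map if the set of points of the target having exactly one pre-image contains a dense $G_\delta$ subset of the target; systems are conjugate if there is a bijective factor map between them. Subodometers: let $\Gamma_0\supseteq\Gamma_1\supseteq\cdots$ be a decreasing sequence of finite-index subgroups of $G$, $G/\Gamma_i=\{g\Gamma_i\}$ discrete, $\pi_i:G/\Gamma_{i+1}\to G/\Gamma_i$ induced by inclusion. The inverse limit $\overleftarrow{G}=\lim_{\leftarrow i}(G/\Gamma_i,\pi_i)$ with the product topology and the action of $G$ by left multiplication on each coordinate is a subodometer. Let $\mathbf{e}=(e\Gamma_i)_{i\ge0}\in\overleftarrow{G}$. When $\bigcap_i\Gamma_i=\{e\}$, the map $\tau:G\to\overleftarrow{G}$, $\tau(g)=g.\mathbf{e}$,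 is injective, and $G$ is identified with $\tau(G)$. Let $K$ be a compact metric space. A function $f:G\to K$ is a semicocycle on $\overleftarrow{G}$ (where $\bigcap_i\Gamma_i=\{e\}$) if it is continuous for the topology on $G$ inherited from $\overleftarrow{G}$ via $\tau$. Functions $f:G\to K$ are viewed as points of $(K^G,G)$, where $K^G$ has the product topology and $(\gamma.f)(g)=f(g\gamma)$; $\Omega_G(f)$ is the closure of the $G$-orbit of $f$ in $K^G$. Let $F=\overline{\{(g,f(g)):g\in G\}}\subseteq\overleftarrow{G}\times K$ and $F(\mathbf{g})=\{k\in K:(\mathbf{g},k)\in F\}$ for $\mathbf{g}\in\overleftarrow{G}$. The semicocycle $f$ is invariant under no rotation if for every $\mathbf{h}_1\ne\mathbf{h}_2$ in $\overleftarrow{G}$ there exists $g\in G$ with $F(g.\mathbf{h}_1)\ne F(g.\mathbf{h}_2)$. *)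

theory Defs
  imports
    "HOL-Analysis.Analysis"
    "HOL-Algebra.Generated_Groups"
    "HOL-Algebra.Group_Action"
    "HOL-Algebra.Left_Coset"
begin

section \<open>Groups\<close>

definition finitely_generated_group :: "('g, 'm) monoid_scheme \<Rightarrow> bool" where
  "finitely_generated_group G \<longleftrightarrow>
     group G \<and> (\<exists>S. finite S \<and> S \<subseteq> carrier G \<and> generate G S = carrier G)"

definition finite_index_chain :: "('g, 'm) monoid_scheme \<Rightarrow> (nat \<Rightarrow> 'g set) \<Rightarrow> bool" where
  "finite_index_chain G \<Gamma> \<longleftrightarrow>
     (\<forall>i. subgroup (\<Gamma> i) G \<and> finite (lcosets\<^bsub>G\<^esub> (\<Gamma> i)) \<and> \<Gamma> (Suc i) \<subseteq> \<Gamma> i)"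

definition residually_finite_group :: "('g, 'm) monoid_scheme \<Rightarrow> bool" where
  "residually_finite_group G \<longleftrightarrow>
     group G \<and> (\<exists>\<Gamma>. finite_index_chain G \<Gamma> \<and> (\<Inter>i. \<Gamma> i) = {\<one>\<^bsub>G\<^esub>})"


section \<open>Topological dynamical systems\<close>

text \<open>
  The phase space is a topology on a carrier set; no particular metric is singled out, since all
  the notions involved are topological. A \<^const>\<open>group_action\<close> consists of extensional
  bijections, so the concrete actions below are restricted to their phase spaces.
\<close>

definition dynamical_system ::
  "('g, 'm) monoid_scheme \<Rightarrow> 'x topology \<Rightarrow> ('g \<Rightarrow> 'x \<Rightarrow> 'x) \<Rightarrow> bool" where
  "dynamical_system G X \<phi> \<longleftrightarrow>
     compact_space X \<and> metrizable_space X \<and> group_action G (topspace X) \<phi> \<and>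
     (\<forall>g\<in>carrier G. homeomorphic_map X X (\<phi> g))"

definition minimal_system ::
  "('g, 'm) monoid_scheme \<Rightarrow> 'x topology \<Rightarrow> ('g \<Rightarrow> 'x \<Rightarrow> 'x) \<Rightarrow> bool" where
  "minimal_system G X \<phi> \<longleftrightarrow>
     dynamical_system G X \<phi> \<and> (\<forall>x\<in>topspace X. X closure_of (orbit G \<phi> x) = topspace X)"

definition factor_map ::
  "('g, 'm) monoid_scheme \<Rightarrow> 'x topology \<Rightarrow> ('g \<Rightarrow> 'x \<Rightarrow> 'x) \<Rightarrow>
   'y topology \<Rightarrow> ('g \<Rightarrow> 'y \<Rightarrow> 'y) \<Rightarrow> ('x \<Rightarrow> 'y) \<Rightarrow> bool" where
  "factor_map G X \<phi> Y \<psi> p \<longleftrightarrow>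
     continuous_map X Y p \<and> p ` topspace X = topspace Y \<and>
     (\<forall>g\<in>carrier G. \<forall>x\<in>topspace X. p (\<phi> g x) = \<psi> g (p x))"

definition almost_one_one_factor_map ::
  "('g, 'm) monoid_scheme \<Rightarrow> 'x topology \<Rightarrow> ('g \<Rightarrow> 'x \<Rightarrow> 'x) \<Rightarrow>
   'y topology \<Rightarrow> ('g \<Rightarrow> 'y \<Rightarrow> 'y) \<Rightarrow> ('x \<Rightarrow> 'y) \<Rightarrow> bool" where
  "almost_one_one_factor_map G X \<phi> Y \<psi> p \<longleftrightarrow>
     factor_map G X \<phi> Y \<psi> p \<and>
     (\<exists>D. D \<subseteq> {y \<in> topspace Y. card {x \<in> topspace X. p x = y} = 1} \<and>
          gdelta_in Y D \<and> Y closure_of D = topspace Y)"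

definition conjugate_systems ::
  "('g, 'm) monoid_scheme \<Rightarrow> 'x topology \<Rightarrow> ('g \<Rightarrow> 'x \<Rightarrow> 'x) \<Rightarrow>
   'y topology \<Rightarrow> ('g \<Rightarrow> 'y \<Rightarrow> 'y) \<Rightarrow> bool" where
  "conjugate_systems G X \<phi> Y \<psi> \<longleftrightarrow>
     (\<exists>p. factor_map G X \<phi> Y \<psi> p \<and> bij_betw p (topspace X) (topspace Y))"


section \<open>Subodometers\<close>

text \<open>
  The map \<open>g \<Gamma>\<^sub>i\<^sub>+\<^sub>1 \<mapsto> g \<Gamma>\<^sub>i\<close>, written as \<open>C \<mapsto> C \<Gamma>\<^sub>i\<close> so as not to choose a
  representative; see \<open>coset_proj_l_coset\<close>.
\<close>

definition coset_proj ::
  "('g, 'm) monoid_scheme \<Rightarrow> (nat \<Rightarrow> 'g set) \<Rightarrow> nat \<Rightarrow> 'g set \<Rightarrow> 'g set" where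
  "coset_proj G \<Gamma> i C = C <#>\<^bsub>G\<^esub> \<Gamma> i"

definition odometer_set :: "('g, 'm) monoid_scheme \<Rightarrow> (nat \<Rightarrow> 'g set) \<Rightarrow> (nat \<Rightarrow> 'g set) set" where
  "odometer_set G \<Gamma> =
     {h. \<forall>i. h i \<in> lcosets\<^bsub>G\<^esub> (\<Gamma> i) \<and> coset_proj G \<Gamma> i (h (Suc i)) = h i}"

definition odometer :: "('g, 'm) monoid_scheme \<Rightarrow> (nat \<Rightarrow> 'g set) \<Rightarrow> (nat \<Rightarrow> 'g set) topology" where
  "odometer G \<Gamma> =
     subtopology (product_topology (\<lambda>i. discrete_topology (lcosets\<^bsub>G\<^esub> (\<Gamma> i))) UNIV)
       (odometer_set G \<Gamma>)"

definition odometer_act ::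
  "('g, 'm) monoid_scheme \<Rightarrow> (nat \<Rightarrow> 'g set) \<Rightarrow> 'g \<Rightarrow> (nat \<Rightarrow> 'g set) \<Rightarrow> (nat \<Rightarrow> 'g set)" where
  "odometer_act G \<Gamma> g = (\<lambda>h\<in>odometer_set G \<Gamma>. \<lambda>i. g <#\<^bsub>G\<^esub> h i)"

definition odometer_base :: "('g, 'm) monoid_scheme \<Rightarrow> (nat \<Rightarrow> 'g set) \<Rightarrow> (nat \<Rightarrow> 'g set)" where
  "odometer_base G \<Gamma> = (\<lambda>i. \<one>\<^bsub>G\<^esub> <#\<^bsub>G\<^esub> \<Gamma> i)"

definition odometer_embed ::
  "('g, 'm) monoid_scheme \<Rightarrow> (nat \<Rightarrow> 'g set) \<Rightarrow> 'g \<Rightarrow> (nat \<Rightarrow> 'g set)" where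
  "odometer_embed G \<Gamma> g = odometer_act G \<Gamma> g (odometer_base G \<Gamma>)"


section \<open>Semicocycles\<close>

text \<open>
  Functions \<open>G \<rightarrow> K\<close> are extensional on the carrier of \<open>G\<close>, so that they are exactly the points
  of the product space \<open>K\<^sup>G\<close>.
\<close>

definition semicocycle ::
  "('g, 'm) monoid_scheme \<Rightarrow> (nat \<Rightarrow> 'g set) \<Rightarrow> 'k topology \<Rightarrow> ('g \<Rightarrow> 'k) \<Rightarrow> bool" where
  "semicocycle G \<Gamma> K f \<longleftrightarrow>
     f \<in> extensional (carrier G) \<and>
     continuous_map (pullback_topology (carrier G) (odometer_embed G \<Gamma>) (odometer G \<Gamma>)) K f"

definition semicocycle_graph ::
  "('g, 'm) monoid_scheme \<Rightarrow> (nat \<Rightarrow> 'g set) \<Rightarrow> 'k topology \<Rightarrow> ('g \<Rightarrow> 'k) \<Rightarrow>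
   ((nat \<Rightarrow> 'g set) \<times> 'k) set" where
  "semicocycle_graph G \<Gamma> K f =
     prod_topology (odometer G \<Gamma>) K closure_of ((\<lambda>g. (odometer_embed G \<Gamma> g, f g)) ` carrier G)"

definition semicocycle_fibre ::
  "('g, 'm) monoid_scheme \<Rightarrow> (nat \<Rightarrow> 'g set) \<Rightarrow> 'k topology \<Rightarrow> ('g \<Rightarrow> 'k) \<Rightarrow>
   (nat \<Rightarrow> 'g set) \<Rightarrow> 'k set" where
  "semicocycle_fibre G \<Gamma> K f h = {k \<in> topspace K. (h, k) \<in> semicocycle_graph G \<Gamma> K f}"

definition invariant_under_no_rotation ::
  "('g, 'm) monoid_scheme \<Rightarrow> (nat \<Rightarrow> 'g set) \<Rightarrow> 'k topology \<Rightarrow> ('g \<Rightarrow> 'k) \<Rightarrow> bool" where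
  "invariant_under_no_rotation G \<Gamma> K f \<longleftrightarrow>
     (\<forall>h1\<in>topspace (odometer G \<Gamma>). \<forall>h2\<in>topspace (odometer G \<Gamma>). h1 \<noteq> h2 \<longrightarrow>
       (\<exists>g\<in>carrier G. semicocycle_fibre G \<Gamma> K f (odometer_act G \<Gamma> g h1)
                    \<noteq> semicocycle_fibre G \<Gamma> K f (odometer_act G \<Gamma> g h2)))"


section \<open>The shift on \<open>K\<^sup>G\<close>\<close>

definition full_shift :: "('g, 'm) monoid_scheme \<Rightarrow> 'k topology \<Rightarrow> ('g \<Rightarrow> 'k) topology" where
  "full_shift G K = product_topology (\<lambda>_. K) (carrier G)"

definition shift_act ::
  "('g, 'm) monoid_scheme \<Rightarrow> 'k topology \<Rightarrow> 'g \<Rightarrow> ('g \<Rightarrow> 'k) \<Rightarrow> ('g \<Rightarrow> 'k)" where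
  "shift_act G K \<gamma> = (\<lambda>x\<in>topspace (full_shift G K). \<lambda>g\<in>carrier G. x (g \<otimes>\<^bsub>G\<^esub> \<gamma>))"

definition orbit_closure :: "('g, 'm) monoid_scheme \<Rightarrow> 'k topology \<Rightarrow> ('g \<Rightarrow> 'k) \<Rightarrow> ('g \<Rightarrow> 'k) set" where
  "orbit_closure G K f = full_shift G K closure_of (orbit G (shift_act G K) f)"

definition orbit_closure_space ::
  "('g, 'm) monoid_scheme \<Rightarrow> 'k topology \<Rightarrow> ('g \<Rightarrow> 'k) \<Rightarrow> ('g \<Rightarrow> 'k) topology" where
  "orbit_closure_space G K f = subtopology (full_shift G K) (orbit_closure G K f)"

definition orbit_closure_act ::
  "('g, 'm) monoid_scheme \<Rightarrow> 'k topology \<Rightarrow> ('g \<Rightarrow> 'k) \<Rightarrow> 'g \<Rightarrow> ('g \<Rightarrow> 'k) \<Rightarrow> ('g \<Rightarrow> 'k)" where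
  "orbit_closure_act G K f \<gamma> = restrict (shift_act G K \<gamma>) (orbit_closure G K f)"


section \<open>Consistency of the encodings\<close>

lemma coset_proj_l_coset:
  assumes "group G" "finite_index_chain G \<Gamma>" "g \<in> carrier G"
  shows "coset_proj G \<Gamma> i (g <#\<^bsub>G\<^esub> \<Gamma> (Suc i)) = g <#\<^bsub>G\<^esub> \<Gamma> i"
proof -
  interpret group G by fact
  have S: "subgroup (\<Gamma> i) G" "subgroup (\<Gamma> (Suc i)) G" and le: "\<Gamma> (Suc i) \<subseteq> \<Gamma> i"
    using assms(2) by (auto simp: finite_index_chain_def)
  have "\<Gamma> (Suc i) <#>\<^bsub>G\<^esub> \<Gamma> i = \<Gamma> i"
  proof
    show "\<Gamma> (Suc i) <#>\<^bsub>G\<^esub> \<Gamma> i \<subseteq> \<Gamma> i"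
      using le subgroup.m_closed[OF S(1)] by (auto simp: set_mult_def)
    have "x = \<one>\<^bsub>G\<^esub> \<otimes>\<^bsub>G\<^esub> x" if "x \<in> \<Gamma> i" for x
      using that subgroup.mem_carrier[OF S(1)] by simp
    then show "\<Gamma> i \<subseteq> \<Gamma> (Suc i) <#>\<^bsub>G\<^esub> \<Gamma> i"
      using subgroup.one_closed[OF S(2)] unfolding set_mult_def by blast
  qed
  moreover have "(g <#\<^bsub>G\<^esub> \<Gamma> (Suc i)) <#>\<^bsub>G\<^esub> \<Gamma> i = g <#\<^bsub>G\<^esub> (\<Gamma> (Suc i) <#>\<^bsub>G\<^esub> \<Gamma> i)"
    using setmult_lcos_assoc[OF subgroup.subset[OF S(2)] subgroup.subset[OF S(1)] assms(3)] by simp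
  ultimately show ?thesis
    by (simp add: coset_proj_def)
qed

lemma topspace_odometer: "topspace (odometer G \<Gamma>) = odometer_set G \<Gamma>"
  by (auto simp: odometer_def odometer_set_def)

lemma odometer_base_in:
  assumes "group G" "finite_index_chain G \<Gamma>"
  shows "odometer_base G \<Gamma> \<in> odometer_set G \<Gamma>"
proof -
  interpret group G by fact
  show ?thesis
    using coset_proj_l_coset[OF assms one_closed]
    by (auto simp: odometer_set_def odometer_base_def LCOSETS_def)
qed

lemma odometer_embed_eq:
  assumes "group G" "finite_index_chain G \<Gamma>" "g \<in> carrier G"
  shows "odometer_embed G \<Gamma> g = (\<lambda>i. g <#\<^bsub>G\<^esub> \<Gamma> i)"
proof -
  interpret group G by fact
  have "\<Gamma> i \<subseteq> carrier G" for i
    using assms(2) by (auto simp: finite_index_chain_def dest: subgroup.subset)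
  then show ?thesis
    using odometer_base_in[OF assms(1,2)] assms(3)
    by (simp add: odometer_embed_def odometer_act_def odometer_base_def lcos_m_assoc)
qed

lemma group_actionI:
  assumes G: "group G"
    and ext: "\<And>g. g \<in> carrier G \<Longrightarrow> \<phi> g \<in> extensional E"
    and cl: "\<And>g x. g \<in> carrier G \<Longrightarrow> x \<in> E \<Longrightarrow> \<phi> g x \<in> E"
    and one: "\<And>x. x \<in> E \<Longrightarrow> \<phi> \<one>\<^bsub>G\<^esub> x = x"
    and mult: "\<And>g h x. g \<in> carrier G \<Longrightarrow> h \<in> carrier G \<Longrightarrow> x \<in> E \<Longrightarrow>
                 \<phi> (g \<otimes>\<^bsub>G\<^esub> h) x = \<phi> g (\<phi> h x)"
  shows "group_action G E \<phi>"
proof -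
  interpret group G by fact
  have bij: "\<phi> g \<in> Bij E" if g: "g \<in> carrier G" for g
  proof -
    have "\<phi> (inv\<^bsub>G\<^esub> g) (\<phi> g x) = x" "\<phi> g (\<phi> (inv\<^bsub>G\<^esub> g) x) = x" if "x \<in> E" for x
      using mult[of "inv\<^bsub>G\<^esub> g" g x] mult[of g "inv\<^bsub>G\<^esub> g" x] that g one by auto
    then have "bij_betw (\<phi> g) E E"
      by (intro bij_betw_byWitness[where f' = "\<phi> (inv\<^bsub>G\<^esub> g)"]) (use cl g in auto)
    then show ?thesis
      using ext[OF g] by (simp add: Bij_def)
  qed
  have "\<phi> \<in> hom G (BijGroup E)"
  proof (rule homI)
    show "\<phi> g \<in> carrier (BijGroup E)" if "g \<in> carrier G" for g
      using bij[OF that] by (simp add: BijGroup_def)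
    show "\<phi> (g \<otimes>\<^bsub>G\<^esub> h) = \<phi> g \<otimes>\<^bsub>BijGroup E\<^esub> \<phi> h" if "g \<in> carrier G" "h \<in> carrier G" for g h
    proof (rule extensionalityI[of _ E])
      show "\<phi> (g \<otimes>\<^bsub>G\<^esub> h) \<in> extensional E" using ext that by simp
      show "\<phi> g \<otimes>\<^bsub>BijGroup E\<^esub> \<phi> h \<in> extensional E"
        using bij that by (simp add: BijGroup_def compose_def)
    qed (use bij that mult in \<open>simp add: BijGroup_def compose_def\<close>)
  qed
  then show ?thesis
    by (simp add: group_action_def group_hom_def group_hom_axioms_def group_BijGroup G)
qed

lemma group_action_odometer:
  assumes "group G" "finite_index_chain G \<Gamma>"
  shows "group_action G (topspace (odometer G \<Gamma>)) (odometer_act G \<Gamma>)"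
proof -
  interpret group G by fact
  have S: "\<Gamma> i \<subseteq> carrier G" for i
    using assms(2) by (auto simp: finite_index_chain_def dest: subgroup.subset)
  have C: "h i \<subseteq> carrier G" if "h \<in> odometer_set G \<Gamma>" for h i
  proof -
    have "h i \<in> lcosets\<^bsub>G\<^esub> (\<Gamma> i)" using that unfolding odometer_set_def by blast
    then show ?thesis using l_coset_subset_G[OF S] unfolding LCOSETS_def by blast
  qed
  have cl: "(\<lambda>i. g <#\<^bsub>G\<^esub> h i) \<in> odometer_set G \<Gamma>"
    if g: "g \<in> carrier G" and h: "h \<in> odometer_set G \<Gamma>" for g h
  proof -
    have "g <#\<^bsub>G\<^esub> h i \<in> lcosets\<^bsub>G\<^esub> (\<Gamma> i)" for i
    proof -
      obtain a where a: "a \<in> carrier G" "h i = a <#\<^bsub>G\<^esub> \<Gamma> i"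
        using h unfolding odometer_set_def LCOSETS_def by blast
      then have "g <#\<^bsub>G\<^esub> h i = (g \<otimes>\<^bsub>G\<^esub> a) <#\<^bsub>G\<^esub> \<Gamma> i"
        using g S lcos_m_assoc by simp
      then show ?thesis using a g by (auto simp: LCOSETS_def)
    qed
    moreover have "coset_proj G \<Gamma> i (g <#\<^bsub>G\<^esub> h (Suc i)) = g <#\<^bsub>G\<^esub> h i" for i
      using setmult_lcos_assoc[OF C[OF h, of "Suc i"] S[of i] g] h
      by (simp add: coset_proj_def odometer_set_def)
    ultimately show ?thesis by (simp add: odometer_set_def)
  qed
  show ?thesis unfolding topspace_odometer
  proof (rule group_actionI[OF assms(1)])
    show "odometer_act G \<Gamma> g \<in> extensional (odometer_set G \<Gamma>)" for g
      by (simp add: odometer_act_def)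
    show "odometer_act G \<Gamma> g h \<in> odometer_set G \<Gamma>"
      if "g \<in> carrier G" "h \<in> odometer_set G \<Gamma>" for g h
      using cl[OF that] that by (simp add: odometer_act_def)
    show "odometer_act G \<Gamma> \<one>\<^bsub>G\<^esub> h = h" if "h \<in> odometer_set G \<Gamma>" for h
      using lcos_mult_one[OF C[OF that]] that by (simp add: odometer_act_def)
    show "odometer_act G \<Gamma> (g \<otimes>\<^bsub>G\<^esub> k) h = odometer_act G \<Gamma> g (odometer_act G \<Gamma> k h)"
      if "g \<in> carrier G" "k \<in> carrier G" "h \<in> odometer_set G \<Gamma>" for g k h
      using cl[OF that(2,3)] lcos_m_assoc[OF C[OF that(3)] that(1,2)] that
      by (simp add: odometer_act_def)
  qed
qed

lemma topspace_full_shift: "topspace (full_shift G K) = (carrier G \<rightarrow>\<^sub>E topspace K)"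
  by (simp add: full_shift_def)

lemma group_action_full_shift:
  assumes "group G"
  shows "group_action G (topspace (full_shift G K)) (shift_act G K)"
proof -
  interpret group G by fact
  have cl: "(\<lambda>g\<in>carrier G. x (g \<otimes>\<^bsub>G\<^esub> \<gamma>)) \<in> carrier G \<rightarrow>\<^sub>E topspace K"
    if "\<gamma> \<in> carrier G" "x \<in> carrier G \<rightarrow>\<^sub>E topspace K" for \<gamma> x
    using that by auto
  show ?thesis
  proof (rule group_actionI[OF assms], unfold topspace_full_shift)
    show "shift_act G K \<gamma> \<in> extensional (carrier G \<rightarrow>\<^sub>E topspace K)" for \<gamma>
      by (simp add: shift_act_def topspace_full_shift)
    show "shift_act G K \<gamma> x \<in> carrier G \<rightarrow>\<^sub>E topspace K"
      if "\<gamma> \<in> carrier G" "x \<in> carrier G \<rightarrow>\<^sub>E topspace K" for \<gamma> x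
      using cl[OF that] that by (simp add: shift_act_def topspace_full_shift)
    show "shift_act G K \<one>\<^bsub>G\<^esub> x = x" if "x \<in> carrier G \<rightarrow>\<^sub>E topspace K" for x
      by (rule extensionalityI[of _ "carrier G"])
        (use that in \<open>simp_all add: shift_act_def topspace_full_shift PiE_def\<close>)
    show "shift_act G K (\<gamma> \<otimes>\<^bsub>G\<^esub> \<delta>) x = shift_act G K \<gamma> (shift_act G K \<delta> x)"
      if "\<gamma> \<in> carrier G" "\<delta> \<in> carrier G" "x \<in> carrier G \<rightarrow>\<^sub>E topspace K" for \<gamma> \<delta> x
      by (rule extensionalityI[of _ "carrier G"])
        (use cl[OF that(2,3)] that in \<open>simp_all add: shift_act_def topspace_full_shift m_assoc\<close>)
  qed
qed

end

theory Submission
  imports Defs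
begin

text \<open>
  If \<open>p\<close> is a factor map with \<open>p\<^sup>-\<^sup>1(\<^bold>e) = {x\<^sub>0}\<close>, then \<open>f(g) = g x\<^sub>0\<close> is a semicocycle with values
  in \<open>X\<close>: its fibre over \<open>h\<close> is \<open>p\<^sup>-\<^sup>1(h)\<close>, and \<open>x \<mapsto> (g \<mapsto> g x)\<close> conjugates \<open>X\<close> to \<open>\<Omega>\<^sub>G(f)\<close>.

  Conversely, let \<open>R\<close> be the closure of \<open>{(\<tau>(g), g.f)}\<close>. If \<open>(h, x) \<in> R\<close> then \<open>x(g) \<in> F(g.h)\<close>
  for all \<open>g\<close>, and all the sets \<open>F(g.h)\<close> are singletons for \<open>h\<close> in a \<open>G\<^sub>\<delta>\<close> set \<open>D \<supseteq> \<tau>(G)\<close>. The point is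
  that \<open>x\<close> determines \<open>h\<close>. Suppose \<open>(h, x), (h', x) \<in> R\<close> with \<open>h \<noteq> h'\<close>, and let \<open>W\<close> be the orbit
  closure of \<open>(h, h')\<close>. Both projections pull open sets containing \<open>\<tau>(G)\<close> back to dense open subsets
  of \<open>W\<close>, so by Baire's theorem \<open>W\<close> contains a pair \<open>(a, b) \<in> D \<times> D\<close>. By compactness \<open>a\<close> and \<open>b\<close>
  are again related to a common point, whence \<open>F(g.a) = F(g.b)\<close> for all \<open>g\<close>, although \<open>a \<noteq> b\<close>
  because \<open>G\<close> acts on cosets by bijections: \<open>f\<close> would be invariant under a rotation.
\<close>

section \<open>Countability of generated subgroups, and factor maps transported along
  conjugacies\<close>

text \<open>Elements of the generated subgroup are values of finite words in \<open>S\<close> and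
  its inverses. Countability of the group is what later keeps an intersection over all translates a
  G-delta set.\<close>

lemma (in group) countable_generate:
  assumes "S \<subseteq> carrier G" "countable S"
  shows "countable (generate G S)"
proof -
  define w where "w = (\<lambda>xs. foldr (\<otimes>) xs \<one>)"
  let ?A = "S \<union> m_inv G ` S"
  have A: "?A \<subseteq> carrier G" using assms(1) by auto
  have wc: "w xs \<in> carrier G" if "xs \<in> lists ?A" for xs
    using that A by (induction xs) (auto simp: w_def)
  have app: "w (xs @ ys) = w xs \<otimes> w ys" if "xs \<in> lists ?A" "ys \<in> lists ?A" for xs ys
    using that(1)
  proof (induction xs)
    case Nil
    then show ?case using wc[OF that(2)] by (simp add: w_def)
  next
    case (Cons a xs)
    have "a \<in> carrier G" using Cons.hyps(1) A by blast
    then show ?case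
      using Cons wc[of xs] wc[OF that(2)] m_assoc[of a "w xs" "w ys"] by (simp add: w_def)
  qed
  have "x \<in> w ` lists ?A" if "x \<in> generate G S" for x
    using that
  proof (induction rule: generate.induct)
    case one
    have "\<one> = w []" by (simp add: w_def)
    then show ?case by blast
  next
    case (incl h)
    then have "h = w [h]" using assms(1) by (auto simp: w_def)
    then show ?case using incl by (intro image_eqI[of _ _ "[h]"]) auto
  next
    case (inv h)
    then have "inv h = w [inv h]" using assms(1) by (auto simp: w_def)
    then show ?case using inv by (intro image_eqI[of _ _ "[inv h]"]) auto
  next
    case (eng g h)
    then obtain xs ys where "xs \<in> lists ?A" "g = w xs" "ys \<in> lists ?A" "h = w ys"
      by blast
    then show ?case by (intro image_eqI[of _ _ "xs @ ys"]) (auto simp: app)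
  qed
  then have "generate G S \<subseteq> w ` lists ?A" by blast
  moreover have "countable (w ` lists ?A)"
    using assms(2) by (intro countable_image countable_lists) simp
  ultimately show ?thesis by (rule countable_subset)
qed

lemma continuous_map_prod:
  assumes "continuous_map X X' u" "continuous_map Y Y' v"
  shows "continuous_map (prod_topology X Y) (prod_topology X' Y') (\<lambda>p. (u (fst p), v (snd p)))"
  using continuous_map_compose[OF continuous_map_fst[of X Y] assms(1)]
    continuous_map_compose[OF continuous_map_snd[of X Y] assms(2)]
  by (simp add: continuous_map_pairwise o_def)

lemma card_vimage_bij_betw:
  assumes "bij_betw c A B"
  shows "card {x \<in> A. P (c x)} = card {y \<in> B. P y}"
proof -
  have "bij_betw c {x \<in> A. P (c x)} {y \<in> B. P y}"
    using assms unfolding bij_betw_def inj_on_def by blast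
  then show ?thesis by (rule bij_betw_same_card)
qed

text \<open>The bijection \<open>c\<close> matches the fibres of \<open>p \<circ> c\<close> with
  those of \<open>p\<close>, so the same dense G-delta set works.\<close>

lemma almost_one_one_factor_map_conjugate:
  assumes c: "factor_map G X \<phi> Y \<psi> c" "bij_betw c (topspace X) (topspace Y)"
    and p: "almost_one_one_factor_map G Y \<psi> Z \<theta> p"
  shows "almost_one_one_factor_map G X \<phi> Z \<theta> (p \<circ> c)"
proof -
  have cX: "c x \<in> topspace Y" if "x \<in> topspace X" for x
    using c(1) that unfolding factor_map_def by blast
  have f: "factor_map G Y \<psi> Z \<theta> p"
    using p by (simp add: almost_one_one_factor_map_def)
  have "continuous_map X Z (p \<circ> c)"
    using c(1) f unfolding factor_map_def by (blast intro: continuous_map_compose)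
  moreover have "(p \<circ> c) ` topspace X = topspace Z"
    using c(1) f unfolding factor_map_def by (metis image_comp)
  moreover have "\<forall>g\<in>carrier G. \<forall>x\<in>topspace X. (p \<circ> c) (\<phi> g x) = \<theta> g ((p \<circ> c) x)"
    using c(1) f cX by (simp add: factor_map_def)
  ultimately have "factor_map G X \<phi> Z \<theta> (p \<circ> c)"
    by (simp add: factor_map_def)
  moreover have "card {x \<in> topspace X. (p \<circ> c) x = z} = card {y \<in> topspace Y. p y = z}" for z
    using card_vimage_bij_betw[OF c(2), of "\<lambda>y. p y = z"] by simp
  ultimately show ?thesis
    using p by (simp add: almost_one_one_factor_map_def)
qed


section \<open>The odometer\<close>

locale subodometer = group G for G (structure) +
  fixes \<Gamma> :: "nat \<Rightarrow> 'a set"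
  assumes chain: "finite_index_chain G \<Gamma>"
begin

abbreviation \<O> where "\<O> \<equiv> odometer G \<Gamma>"
abbreviation \<tau> where "\<tau> \<equiv> odometer_embed G \<Gamma>"
abbreviation act where "act \<equiv> odometer_act G \<Gamma>"

lemma \<Gamma>_subset: "\<Gamma> i \<subseteq> carrier G"
  using chain by (auto simp: finite_index_chain_def dest: subgroup.subset)

lemma finite_lcosets: "finite (lcosets \<Gamma> i)"
  using chain by (simp add: finite_index_chain_def)

lemma odometer_lcosets: "h \<in> topspace \<O> \<Longrightarrow> h i \<in> lcosets \<Gamma> i"
  unfolding topspace_odometer odometer_set_def by blast

text \<open>Coherence under the coset projections lets a representative at level \<open>i\<close>
  serve at all lower levels. Thus every point agrees with some \<open>\<tau> \<delta>\<close> on any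
  initial segment.\<close>

lemma odometer_repr:
  assumes "h \<in> topspace \<O>"
  shows "\<exists>\<delta>\<in>carrier G. \<forall>j\<le>i. h j = \<delta> <# \<Gamma> j"
proof -
  obtain \<delta> where \<delta>: "\<delta> \<in> carrier G" "h i = \<delta> <# \<Gamma> i"
    using odometer_lcosets[OF assms, of i] unfolding LCOSETS_def by blast
  have "h j = \<delta> <# \<Gamma> j" if "j \<le> i" for j
    using that
  proof (induction rule: inc_induct)
    case (step n)
    have "h n = coset_proj G \<Gamma> n (h (Suc n))"
      using assms by (simp add: topspace_odometer odometer_set_def)
    then show ?case
      using step.IH coset_proj_l_coset[OF is_group chain \<delta>(1)] by simp
  qed (rule \<delta>)
  then show ?thesis using \<delta>(1) by blast
qed

lemma odometer_eq_below:
  assumes "h \<in> topspace \<O>" "h' \<in> topspace \<O>" "h i = h' i" "j \<le> i"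
  shows "h j = h' j"
  using \<open>j \<le> i\<close>
proof (induction rule: inc_induct)
  case (step n)
  have "k n = coset_proj G \<Gamma> n (k (Suc n))" if "k \<in> topspace \<O>" for k
    using that by (simp add: topspace_odometer odometer_set_def)
  then show ?case
    using assms(1,2) step.IH by metis
qed (rule assms)

interpretation odometer_action: group_action G "topspace \<O>" act
  by (rule group_action_odometer[OF is_group chain])

lemma act_closed: "g \<in> carrier G \<Longrightarrow> h \<in> topspace \<O> \<Longrightarrow> act g h \<in> topspace \<O>"
  using odometer_action.element_image by blast

lemma act_mult:
  "g \<in> carrier G \<Longrightarrow> k \<in> carrier G \<Longrightarrow> h \<in> topspace \<O> \<Longrightarrow> act (g \<otimes> k) h = act g (act k h)"
  using odometer_action.composition_rule by blast

lemma act_one: "h \<in> topspace \<O> \<Longrightarrow> act \<one> h = h"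
  using odometer_action.id_eq_one by (metis restrict_apply')

lemma act_coord: "h \<in> topspace \<O> \<Longrightarrow> act g h i = g <# h i"
  by (simp add: odometer_act_def topspace_odometer)

lemma act_inv: "g \<in> carrier G \<Longrightarrow> h \<in> topspace \<O> \<Longrightarrow> act (inv g) (act g h) = h"
  using act_mult[of "inv g" g h] by (simp add: act_one)

lemma \<tau>_coord: "g \<in> carrier G \<Longrightarrow> \<tau> g i = g <# \<Gamma> i"
  using odometer_embed_eq[OF is_group chain] by simp

lemma base_in: "odometer_base G \<Gamma> \<in> topspace \<O>"
  using odometer_base_in[OF is_group chain] by (simp add: topspace_odometer)

lemma \<tau>_in: "g \<in> carrier G \<Longrightarrow> \<tau> g \<in> topspace \<O>"
  by (simp add: odometer_embed_def act_closed base_in)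

lemma act_\<tau>: "g \<in> carrier G \<Longrightarrow> k \<in> carrier G \<Longrightarrow> act g (\<tau> k) = \<tau> (g \<otimes> k)"
  by (simp add: odometer_embed_def act_mult base_in)

lemma \<tau>_one: "\<tau> \<one> = odometer_base G \<Gamma>"
  by (simp add: odometer_embed_def act_one base_in)

lemma continuous_map_odometer_coord:
  "continuous_map \<O> (discrete_topology (lcosets \<Gamma> i)) (\<lambda>h. h i)"
  unfolding odometer_def
  by (intro continuous_map_from_subtopology continuous_map_product_projection) simp

lemma openin_cylinder: "openin \<O> {h \<in> topspace \<O>. h i \<in> A}"
proof -
  have "openin \<O> {h \<in> topspace \<O>. h i \<in> A \<inter> lcosets \<Gamma> i}"
    by (rule openin_continuous_map_preimage[OF continuous_map_odometer_coord]) simp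
  moreover have "{h \<in> topspace \<O>. h i \<in> A \<inter> lcosets \<Gamma> i} = {h \<in> topspace \<O>. h i \<in> A}"
    using odometer_lcosets by blast
  ultimately show ?thesis by simp
qed

text \<open>The coherence conditions are closed in a product of finite discrete spaces, which is
  compact.\<close>

lemma compact_space_odometer: "compact_space \<O>"
proof -
  let ?P = "product_topology (\<lambda>i. discrete_topology (lcosets \<Gamma> i)) UNIV"
  have "closedin ?P {h \<in> topspace ?P. coset_proj G \<Gamma> i (h (Suc i)) = h i}" for i
  proof -
    \<comment> \<open>With \<open>UNIV\<close> as discrete target, an arbitrary function of one
      coordinate is continuous, whatever its values.\<close>
    have c: "continuous_map ?P (discrete_topology UNIV) (\<lambda>h. F (h j))" for j and F :: "'a set \<Rightarrow> 'a set"
      using continuous_map_compose[OF continuous_map_product_projection[of j UNIV "\<lambda>i. discrete_topology (lcosets \<Gamma> i)"],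
          of "discrete_topology UNIV" F]
      by (simp add: o_def)
    show ?thesis
      by (rule closedin_continuous_maps_eq[OF _ c c[where F = "\<lambda>x. x"]]) (simp add: Hausdorff_space_discrete_topology)
  qed
  then have "closedin ?P (\<Inter>i. {h \<in> topspace ?P. coset_proj G \<Gamma> i (h (Suc i)) = h i})"
    by (intro closedin_Inter) auto
  moreover have "(\<Inter>i. {h \<in> topspace ?P. coset_proj G \<Gamma> i (h (Suc i)) = h i}) = odometer_set G \<Gamma>"
    by (auto simp: odometer_set_def)
  moreover have "compact_space ?P"
    using finite_lcosets by (simp add: compact_space_product_topology compact_space_discrete_topology)
  ultimately show ?thesis
    unfolding odometer_def by (metis closedin_compact_space compact_space_subtopology)
qed

lemma Hausdorff_space_odometer: "Hausdorff_space \<O>"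
  unfolding odometer_def
  by (intro Hausdorff_space_subtopology) (simp add: Hausdorff_space_product_topology Hausdorff_space_discrete_topology)

text \<open>A basic open set constrains finitely many coordinates, and one coordinate of high level
  determines all lower ones. Allowing every \<open>j \<ge> i\<close> lets the levels of several open
  sets be merged by a maximum.\<close>

lemma open_contains_cylinder:
  assumes "openin \<O> U" "h \<in> U"
  shows "\<exists>i. \<forall>h'\<in>topspace \<O>. \<forall>j\<ge>i. h' j = h j \<longrightarrow> h' \<in> U"
proof -
  have hO: "h \<in> topspace \<O>" using assms openin_subset by blast
  obtain T where T: "openin (product_topology (\<lambda>i. discrete_topology (lcosets \<Gamma> i)) UNIV) T"
      "U = T \<inter> odometer_set G \<Gamma>"
    using assms(1) unfolding odometer_def openin_subtopology by blast
  obtain B where B: "finite {i. B i \<noteq> lcosets \<Gamma> i}" "h \<in> Pi\<^sub>E UNIV B" "Pi\<^sub>E UNIV B \<subseteq> T"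
    using T assms(2) unfolding openin_product_topology_alt by auto
  obtain i where i: "\<And>j. B j \<noteq> lcosets \<Gamma> j \<Longrightarrow> j \<le> i"
    using B(1) finite_nat_set_iff_bounded_le by auto
  have "h' \<in> U" if h': "h' \<in> topspace \<O>" "i \<le> j" "h' j = h j" for h' j
  proof -
    have "h' k \<in> B k" for k
    proof (cases "B k = lcosets \<Gamma> k")
      case False
      then have "h' k = h k" using odometer_eq_below[OF h'(1) hO h'(3)] i h'(2) by (meson le_trans)
      then show ?thesis using B(2) by auto
    qed (use odometer_lcosets[OF h'(1)] in auto)
    then show "h' \<in> U" using B(3) T(2) h'(1) unfolding topspace_odometer by auto
  qed
  then show ?thesis by blast
qed

text \<open>The action is coordinatewise, so agreement with \<open>h\<close> at level
  \<open>i\<close> gives agreement of the images at level \<open>i\<close>.\<close>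

lemma continuous_map_act:
  assumes "g \<in> carrier G" shows "continuous_map \<O> \<O> (act g)"
proof (subst continuous_map_openin_preimage_eq, intro conjI allI impI)
  show "act g \<in> topspace \<O> \<rightarrow> topspace \<O>" using act_closed[OF assms] by auto
  fix U assume U: "openin \<O> U"
  show "openin \<O> (topspace \<O> \<inter> act g -` U)"
  proof (subst openin_subopen, clarify)
    fix h assume h: "h \<in> topspace \<O>" "act g h \<in> U"
    obtain i where i: "\<forall>h'\<in>topspace \<O>. \<forall>j\<ge>i. h' j = act g h j \<longrightarrow> h' \<in> U"
      using open_contains_cylinder[OF U h(2)] by blast
    have "act g h' \<in> U" if "h' \<in> topspace \<O>" "h' i = h i" for h'
      using bspec[OF i act_closed[OF assms that(1)]] that h(1) by (auto simp: act_coord)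
    then have "{h' \<in> topspace \<O>. h' i \<in> {h i}} \<subseteq> topspace \<O> \<inter> act g -` U"
      by blast
    then show "\<exists>T. openin \<O> T \<and> h \<in> T \<and> T \<subseteq> topspace \<O> \<inter> act g -` U"
      using openin_cylinder[of i "{h i}"] h(1) by blast
  qed
qed

lemma dense_\<tau>: "\<O> closure_of (\<tau> ` carrier G) = topspace \<O>"
proof -
  have "h \<in> \<O> closure_of (\<tau> ` carrier G)" if h: "h \<in> topspace \<O>" for h
    unfolding in_closure_of
  proof (intro conjI allI impI h)
    fix U assume U: "h \<in> U \<and> openin \<O> U"
    obtain i where i: "\<forall>h'\<in>topspace \<O>. \<forall>j\<ge>i. h' j = h j \<longrightarrow> h' \<in> U"
      using open_contains_cylinder[of U h] U by blast
    obtain \<delta> where \<delta>: "\<delta> \<in> carrier G" "h i = \<delta> <# \<Gamma> i" using odometer_repr[OF h, of i] by blast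
    have "\<tau> \<delta> \<in> U" "\<tau> \<delta> \<in> \<tau> ` carrier G"
      using bspec[OF i \<tau>_in[OF \<delta>(1)]] \<delta> by (auto simp: \<tau>_coord)
    then show "\<exists>y. y \<in> \<tau> ` carrier G \<and> y \<in> U" by blast
  qed
  then show ?thesis by (intro equalityI closure_of_subset_topspace subsetI)
qed

text \<open>
  Writing \<open>h k = \<delta>\<^sub>k \<Gamma>\<^sub>k\<close>, the element \<open>\<delta>\<^sub>k \<delta>\<^sub>l\<^sup>-\<^sup>1\<close> with \<open>l\<close> large moves \<open>h\<close> close to \<open>\<tau> \<delta>\<^sub>k \<in> U\<close>.
  The \<open>\<Gamma> i\<close> need not be normal, so fixing \<open>h' i\<close> at the same time requires
  \<open>\<delta>\<^sub>k\<^sup>-\<^sup>1 (h' i) = \<delta>\<^sub>l\<^sup>-\<^sup>1 (h' i)\<close>; the pigeonhole principle provides such \<open>k\<close> and \<open>l\<close>.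
\<close>

lemma return_map:
  assumes h: "h \<in> topspace \<O>" and h': "h' \<in> topspace \<O>"
    and U: "openin \<O> U" "\<tau> ` carrier G \<subseteq> U"
  shows "\<exists>g\<in>carrier G. act g h \<in> U \<and> act g h i = h i \<and> act g h' i = h' i"
proof -
  have "\<forall>k. \<exists>\<delta>. \<delta> \<in> carrier G \<and> (\<forall>j\<le>k. h j = \<delta> <# \<Gamma> j)"
    using odometer_repr[OF h] by (simp add: Bex_def)
  then obtain \<delta> where "\<forall>k. \<delta> k \<in> carrier G \<and> (\<forall>j\<le>k. h j = \<delta> k <# \<Gamma> j)"
    by (rule choice[elim_format]) blast
  then have \<delta>: "\<And>k. \<delta> k \<in> carrier G" "\<And>k j. j \<le> k \<Longrightarrow> h j = \<delta> k <# \<Gamma> j"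
    by simp_all
  have "(\<lambda>k. act (inv (\<delta> k)) h' i) ` {i..} \<subseteq> lcosets \<Gamma> i"
    using odometer_lcosets act_closed h' \<delta>(1) by auto
  then have "finite ((\<lambda>k. act (inv (\<delta> k)) h' i) ` {i..})"
    using finite_lcosets finite_subset by blast
  then obtain k where k: "i \<le> k"
      and inf: "infinite {l \<in> {i..}. act (inv (\<delta> l)) h' i = act (inv (\<delta> k)) h' i}"
    using pigeonhole_infinite[OF infinite_Ici] by auto
  have "\<tau> (\<delta> k) \<in> U"
    using U(2) \<delta>(1) by blast
  then obtain j where j: "\<forall>h'\<in>topspace \<O>. \<forall>l\<ge>j. h' l = \<tau> (\<delta> k) l \<longrightarrow> h' \<in> U"
    using open_contains_cylinder[OF U(1)] by blast
  \<comment> \<open>The level \<open>j\<close> depends on \<open>\<delta> k\<close>, so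
    \<open>l\<close> has to be chosen after \<open>k\<close>; hence the need for infinitely many
    repetitions instead of one.\<close>
  obtain l where l: "l \<ge> max k j" "act (inv (\<delta> l)) h' i = act (inv (\<delta> k)) h' i"
    using inf unfolding infinite_nat_iff_unbounded_le by blast
  define g where "g = \<delta> k \<otimes> inv (\<delta> l)"
  have g: "g \<in> carrier G" using \<delta>(1) by (simp add: g_def)
  have gh: "act g h m = \<delta> k <# \<Gamma> m" if "m \<le> l" for m
  proof -
    have "act g h m = g <# (\<delta> l <# \<Gamma> m)" using act_coord[OF h] \<delta>(2)[OF that] by simp
    also have "\<dots> = (g \<otimes> \<delta> l) <# \<Gamma> m" using g \<delta>(1) \<Gamma>_subset by (simp add: lcos_m_assoc)
    also have "g \<otimes> \<delta> l = \<delta> k" using \<delta>(1) by (simp add: g_def m_assoc)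
    finally show ?thesis .
  qed
  show ?thesis
  proof (intro bexI[OF _ g] conjI)
    show "act g h \<in> U"
      using bspec[OF j act_closed[OF g h]] gh[of l] l(1) \<delta>(1) by (auto simp: \<tau>_coord)
    show "act g h i = h i" using gh[of i] \<delta>(2)[of i k] k l(1) by simp
    have "act g h' i = act (\<delta> k) (act (inv (\<delta> l)) h') i"
      using \<delta>(1) h' by (simp add: g_def act_mult)
    also have "\<dots> = act (\<delta> k) (act (inv (\<delta> k)) h') i"
      using l(2) \<delta>(1) h' by (simp add: act_coord[OF act_closed])
    also have "\<dots> = h' i"
      using act_mult[of "\<delta> k" "inv (\<delta> k)" h'] \<delta>(1) h' by (simp add: act_one)
    finally show "act g h' i = h' i" .
  qed
qed

end


section \<open>The orbit closure of a semicocycle\<close>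

locale semicocycle_shift = subodometer G \<Gamma> for G (structure) and \<Gamma> +
  fixes K :: "'k topology" and f :: "'a \<Rightarrow> 'k"
  assumes countable_carrier: "countable (carrier G)"
    and compact_K: "compact_space K" and metrizable_K: "metrizable_space K"
    and semicocycle_f: "semicocycle G \<Gamma> K f"
    and no_rotation: "invariant_under_no_rotation G \<Gamma> K f"
begin

abbreviation \<S> where "\<S> \<equiv> full_shift G K"
abbreviation shift where "shift \<equiv> shift_act G K"
abbreviation fibre where "fibre \<equiv> semicocycle_fibre G \<Gamma> K f"

text \<open>
  The orbit closure of \<open>(\<^bold>e, f)\<close>. By \<open>\<R>_left_unique\<close> below, its converse is the graph of
  the factor map from \<open>\<Omega>\<^sub>G(f)\<close> to the odometer.
\<close>

definition \<R> where
  "\<R> = prod_topology \<O> \<S> closure_of ((\<lambda>\<gamma>. (\<tau> \<gamma>, shift \<gamma> f)) ` carrier G)"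

interpretation shift_action: group_action G "topspace \<S>" shift
  by (rule group_action_full_shift[OF is_group])

lemma compact_space_shift: "compact_space \<S>"
  by (simp add: full_shift_def compact_space_product_topology compact_K)

lemma f_closed: "g \<in> carrier G \<Longrightarrow> f g \<in> topspace K"
proof -
  assume "g \<in> carrier G"
  then have "g \<in> topspace (pullback_topology (carrier G) \<tau> \<O>)"
    by (simp add: topspace_pullback_topology \<tau>_in)
  then show ?thesis
    using semicocycle_f unfolding semicocycle_def continuous_map_def by blast
qed

lemma f_in: "f \<in> topspace \<S>"
  using f_closed semicocycle_f by (auto simp: topspace_full_shift semicocycle_def PiE_def)

lemma shift_closed: "g \<in> carrier G \<Longrightarrow> x \<in> topspace \<S> \<Longrightarrow> shift g x \<in> topspace \<S>"
  using shift_action.element_image by blast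

lemma shift_mult:
  "g \<in> carrier G \<Longrightarrow> k \<in> carrier G \<Longrightarrow> x \<in> topspace \<S> \<Longrightarrow> shift (g \<otimes> k) x = shift g (shift k x)"
  using shift_action.composition_rule by blast

lemma shift_apply:
  "x \<in> topspace \<S> \<Longrightarrow> g \<in> carrier G \<Longrightarrow> shift \<gamma> x g = x (g \<otimes> \<gamma>)"
  by (simp add: shift_act_def)

lemma continuous_map_eval: "g \<in> carrier G \<Longrightarrow> continuous_map \<S> K (\<lambda>x. x g)"
  unfolding full_shift_def by (rule continuous_map_product_projection)

lemma continuous_map_shift:
  assumes "\<gamma> \<in> carrier G" shows "continuous_map \<S> \<S> (shift \<gamma>)"
proof -
  have "continuous_map \<S> (product_topology (\<lambda>_. K) (carrier G)) (shift \<gamma>)"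
    unfolding continuous_map_componentwise
  proof (intro conjI ballI)
    show "shift \<gamma> ` topspace \<S> \<subseteq> extensional (carrier G)"
      by (auto simp: shift_act_def)
    fix k assume k: "k \<in> carrier G"
    show "continuous_map \<S> K (\<lambda>x. shift \<gamma> x k)"
      by (rule continuous_map_eq[OF continuous_map_eval[of "k \<otimes> \<gamma>"]])
        (use k assms in \<open>simp_all add: shift_apply\<close>)
  qed
  then show ?thesis by (simp add: full_shift_def)
qed

lemma orbit_eq: "orbit G shift f = (\<lambda>\<gamma>. shift \<gamma> f) ` carrier G"
  unfolding orbit_def by blast

lemma \<R>_subset: "\<R> \<subseteq> topspace \<O> \<times> topspace \<S>"
  unfolding \<R>_def by (metis closure_of_subset_topspace topspace_prod_topology)

lemma closedin_\<R>: "closedin (prod_topology \<O> \<S>) \<R>"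
  by (simp add: \<R>_def)

lemma \<R>_generators: "\<gamma> \<in> carrier G \<Longrightarrow> (\<tau> \<gamma>, shift \<gamma> f) \<in> \<R>"
  unfolding \<R>_def
  by (rule set_mp[OF closure_of_subset]) (auto simp: \<tau>_in shift_closed f_in)

text \<open>The generating pairs form an orbit of the diagonal action, and continuity passes
  invariance to the closure.\<close>

lemma \<R>_act:
  assumes "(h, x) \<in> \<R>" "g \<in> carrier G"
  shows "(act g h, shift g x) \<in> \<R>"
proof -
  let ?m = "\<lambda>p. (act g (fst p), shift g (snd p))"
  have "?m (h, x) \<in> prod_topology \<O> \<S> closure_of (?m ` (\<lambda>\<gamma>. (\<tau> \<gamma>, shift \<gamma> f)) ` carrier G)"
    using continuous_map_image_closure_subset[OF continuous_map_prod[OF continuous_map_act continuous_map_shift]]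
      assms unfolding \<R>_def by (meson image_subset_iff)
  moreover have "?m ` (\<lambda>\<gamma>. (\<tau> \<gamma>, shift \<gamma> f)) ` carrier G \<subseteq> (\<lambda>\<gamma>. (\<tau> \<gamma>, shift \<gamma> f)) ` carrier G"
  proof clarify
    fix \<gamma> assume "\<gamma> \<in> carrier G"
    then show "(act g (fst (\<tau> \<gamma>, shift \<gamma> f)), shift g (snd (\<tau> \<gamma>, shift \<gamma> f)))
        \<in> (\<lambda>\<gamma>. (\<tau> \<gamma>, shift \<gamma> f)) ` carrier G"
      using assms(2) by (intro image_eqI[of _ _ "g \<otimes> \<gamma>"]) (auto simp: act_\<tau> shift_mult f_in)
  qed
  ultimately show ?thesis
    unfolding \<R>_def using closure_of_mono by fastforce
qed

text \<open>Translating by \<open>g\<close> and evaluating at \<open>g\<close> sends the generator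
  of index \<open>\<gamma>\<close> to
  \<open>(\<tau> (g \<otimes> \<gamma>), f (g \<otimes> \<gamma>))\<close>, a point of the graph of
  \<open>f\<close>; continuity extends this to the closures.\<close>

lemma \<R>_fibre:
  assumes "(h, x) \<in> \<R>" "g \<in> carrier G"
  shows "x g \<in> fibre (act g h)"
proof -
  let ?m = "\<lambda>p. (act g (fst p), (snd p) g)"
  have "?m (h, x) \<in> prod_topology \<O> K closure_of (?m ` (\<lambda>\<gamma>. (\<tau> \<gamma>, shift \<gamma> f)) ` carrier G)"
    using continuous_map_image_closure_subset[OF continuous_map_prod[OF continuous_map_act continuous_map_eval]]
      assms unfolding \<R>_def by (meson image_subset_iff)
  moreover have "?m ` (\<lambda>\<gamma>. (\<tau> \<gamma>, shift \<gamma> f)) ` carrier G \<subseteq> (\<lambda>\<gamma>. (\<tau> \<gamma>, f \<gamma>)) ` carrier G"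
  proof clarify
    fix \<gamma> assume "\<gamma> \<in> carrier G"
    then show "(act g (fst (\<tau> \<gamma>, shift \<gamma> f)), snd (\<tau> \<gamma>, shift \<gamma> f) g) \<in> (\<lambda>\<gamma>. (\<tau> \<gamma>, f \<gamma>)) ` carrier G"
      using assms(2) by (intro image_eqI[of _ _ "g \<otimes> \<gamma>"]) (auto simp: act_\<tau> shift_apply f_in)
  qed
  ultimately have "(act g h, x g) \<in> semicocycle_graph G \<Gamma> K f"
    unfolding semicocycle_graph_def using closure_of_mono by fastforce
  moreover have "x g \<in> topspace K"
    using assms \<R>_subset by (auto simp: topspace_full_shift)
  ultimately show ?thesis by (simp add: semicocycle_fibre_def)
qed

lemma fst_\<R>: "fst ` \<R> = topspace \<O>"
proof
  have "closedin \<O> (fst ` \<R>)"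
    using Abstract_Topological_Spaces.closed_map_fst[OF compact_space_shift] closedin_\<R>
    unfolding closed_map_def by blast
  moreover have "\<tau> ` carrier G \<subseteq> fst ` \<R>"
    using \<R>_generators by force
  ultimately show "topspace \<O> \<subseteq> fst ` \<R>"
    using closure_of_minimal dense_\<tau> by metis
qed (use \<R>_subset in force)

text \<open>Compactness of the odometer makes the image closed, which gives one inclusion;
  continuity of the projection gives the other.\<close>

lemma snd_\<R>: "snd ` \<R> = orbit_closure G K f"
proof
  have "closedin \<S> (snd ` \<R>)"
    using Abstract_Topological_Spaces.closed_map_snd[OF compact_space_odometer] closedin_\<R>
    unfolding closed_map_def by blast
  moreover have "orbit G shift f \<subseteq> snd ` \<R>"
    using \<R>_generators unfolding orbit_eq by force
  ultimately show "orbit_closure G K f \<subseteq> snd ` \<R>"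
    unfolding orbit_closure_def by (rule closure_of_minimal[rotated])
  have "snd ` \<R> \<subseteq> \<S> closure_of (snd ` (\<lambda>\<gamma>. (\<tau> \<gamma>, shift \<gamma> f)) ` carrier G)"
    unfolding \<R>_def by (rule continuous_map_image_closure_subset[OF continuous_map_snd])
  then show "snd ` \<R> \<subseteq> orbit_closure G K f"
    unfolding orbit_closure_def orbit_eq by (simp add: image_image)
qed

section \<open>Points over which the fibres are single-valued\<close>

lemma single_valued_fibre:
  obtains U :: "nat \<Rightarrow> (nat \<Rightarrow> 'a set) set" where
    "\<And>n. openin \<O> (U n)" "\<And>n. \<tau> ` carrier G \<subseteq> U n"
    "\<And>h k l. (\<And>n. h \<in> U n) \<Longrightarrow> k \<in> fibre h \<Longrightarrow> l \<in> fibre h \<Longrightarrow> k = l"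
proof -
  obtain M d where "Metric_space M d" and K: "K = Metric_space.mtopology M d"
    using metrizable_K unfolding metrizable_space_def by blast
  then interpret Metric_space M d by simp
  define small where "small n V \<longleftrightarrow> openin \<O> V \<and>
    (\<forall>a\<in>carrier G. \<forall>b\<in>carrier G. \<tau> a \<in> V \<longrightarrow> \<tau> b \<in> V \<longrightarrow> d (f a) (f b) < 1 / Suc n)" for n V
  have fM: "f g \<in> M" if "g \<in> carrier G" for g
    using f_closed[OF that] by (simp add: K)
  show thesis
  proof (rule that[of "\<lambda>n. \<Union>{V. small n V}"])
    show "openin \<O> (\<Union>{V. small n V})" for n
      by (auto simp: small_def)
    show "\<tau> ` carrier G \<subseteq> \<Union>{V. small n V}" for n
    proof
      fix y assume "y \<in> \<tau> ` carrier G"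
      then obtain g where g: "g \<in> carrier G" "y = \<tau> g" by blast
      \<comment> \<open>Half the tolerance, so that any two values in the ball are within
        \<open>1 / Suc n\<close> of each other.\<close>
      let ?B = "mball (f g) (1 / (2 * Suc n))"
      have "openin (pullback_topology (carrier G) \<tau> \<O>)
              {a \<in> topspace (pullback_topology (carrier G) \<tau> \<O>). f a \<in> ?B}"
        using semicocycle_f openin_continuous_map_preimage[of _ K f ?B]
        by (simp add: semicocycle_def K)
      then obtain V where V: "openin \<O> V"
          "{a \<in> topspace (pullback_topology (carrier G) \<tau> \<O>). f a \<in> ?B} = \<tau> -` V \<inter> carrier G"
        unfolding openin_pullback_topology by blast
      then have eq: "a \<in> carrier G \<and> \<tau> a \<in> V \<longleftrightarrow> a \<in> carrier G \<and> f a \<in> ?B" for a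
        using \<tau>_in by (auto simp: topspace_pullback_topology set_eq_iff)
      have "d (f a) (f b) < 1 / Suc n"
        if "a \<in> carrier G" "b \<in> carrier G" "\<tau> a \<in> V" "\<tau> b \<in> V" for a b
      proof -
        have "d (f g) (f a) < 1 / (2 * Suc n)" "d (f g) (f b) < 1 / (2 * Suc n)"
          using eq that by auto
        moreover have "d (f a) (f b) \<le> d (f g) (f a) + d (f g) (f b)"
          using triangle[of "f a" "f g" "f b"] fM that g commute by metis
        ultimately have "d (f a) (f b) < 1 / (2 * Suc n) + 1 / (2 * Suc n)" by linarith
        then show ?thesis by (simp add: field_simps)
      qed
      then have "small n V" using V(1) by (simp add: small_def)
      moreover have "y \<in> V" using eq[of g] g fM by simp
      ultimately show "y \<in> \<Union>{V. small n V}" by blast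
    qed
    fix h k l assume h: "\<And>n. h \<in> \<Union>{V. small n V}" and k: "k \<in> fibre h" and l: "l \<in> fibre h"
    have kl: "k \<in> M" "l \<in> M" using k l by (simp_all add: semicocycle_fibre_def K)
    \<comment> \<open>Points of the fibre over \<open>h\<close> are limits of values
      \<open>f a\<close> with \<open>\<tau> a\<close> tending to \<open>h\<close>.\<close>
    have near: "\<exists>a\<in>carrier G. \<tau> a \<in> V \<and> d k' (f a) < e"
      if k': "k' \<in> fibre h" and V: "openin \<O> V" "h \<in> V" and e: "e > 0" for k' V e
    proof -
      have "(h, k') \<in> prod_topology \<O> K closure_of ((\<lambda>g. (\<tau> g, f g)) ` carrier G)"
        using k' by (simp add: semicocycle_fibre_def semicocycle_graph_def)
      moreover have "openin (prod_topology \<O> K) (V \<times> mball k' e)"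
        using V(1) by (simp add: openin_prod_Times_iff K)
      moreover have "(h, k') \<in> V \<times> mball k' e"
        using V(2) e k' by (simp add: semicocycle_fibre_def K)
      ultimately obtain y where "y \<in> (\<lambda>g. (\<tau> g, f g)) ` carrier G" "y \<in> V \<times> mball k' e"
        unfolding in_closure_of by metis
      then show ?thesis by auto
    qed
    have "d k l < 3 / Suc n" for n
    proof -
      obtain V where V: "small n V" "h \<in> V" using h[of n] by blast
      obtain a where a: "a \<in> carrier G" "\<tau> a \<in> V" "d k (f a) < 1 / Suc n"
        using near[OF k, of V "1 / Suc n"] V by (auto simp: small_def)
      obtain b where b: "b \<in> carrier G" "\<tau> b \<in> V" "d l (f b) < 1 / Suc n"
        using near[OF l, of V "1 / Suc n"] V by (auto simp: small_def)
      have "d k l \<le> d k (f a) + d (f a) l" "d (f a) l \<le> d (f a) (f b) + d (f b) l"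
        using triangle kl fM a(1) b(1) by blast+
      moreover have "d (f b) l = d l (f b)" by (rule commute)
      moreover have "d (f a) (f b) < 1 / Suc n"
        using V(1) a b by (simp add: small_def)
      moreover have "3 / Suc n = 1 / Suc n + 1 / Suc n + 1 / real (Suc n)" by (simp add: field_simps)
      ultimately show ?thesis using a(3) b(3) by linarith
    qed
    then have "d k l \<le> 0"
      using LIMSEQ_le_const[of "\<lambda>n. 3 / real (Suc n)" 0 "d k l"]
        LIMSEQ_Suc[OF lim_const_over_n[of "3::real"]] less_imp_le by blast
    then show "k = l" using kl zero nonneg[of k l] by (metis order_antisym)
  qed
qed

text \<open>Only uniqueness is demanded; nonemptiness of the fibres along the orbit comes from
  \<open>\<R>_fibre\<close> once \<open>h\<close> is related to some function.\<close>

definition single_valued_at where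
  "single_valued_at h \<longleftrightarrow> (\<forall>g\<in>carrier G. \<forall>k\<in>fibre (act g h). \<forall>l\<in>fibre (act g h). k = l)"

lemma single_valued_orbit:
  "\<exists>\<V>. countable \<V> \<and> (\<forall>V\<in>\<V>. openin \<O> V \<and> \<tau> ` carrier G \<subseteq> V) \<and>
       (\<forall>h\<in>topspace \<O>. h \<in> \<Inter>\<V> \<longrightarrow> single_valued_at h)"
proof -
  obtain U :: "nat \<Rightarrow> (nat \<Rightarrow> 'a set) set" where U: "\<And>n. openin \<O> (U n)" "\<And>n. \<tau> ` carrier G \<subseteq> U n"
    "\<And>h k l. (\<And>n. h \<in> U n) \<Longrightarrow> k \<in> fibre h \<Longrightarrow> l \<in> fibre h \<Longrightarrow> k = l"
    using single_valued_fibre by metis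
  define V where "V g n = {h \<in> topspace \<O>. act g h \<in> U n}" for g n
  let ?\<V> = "(\<lambda>(g, n). V g n) ` (carrier G \<times> UNIV)"
  have "countable ?\<V>"
    using countable_carrier by blast
  moreover have "openin \<O> W \<and> \<tau> ` carrier G \<subseteq> W" if W: "W \<in> ?\<V>" for W
  proof -
    obtain g n where g: "g \<in> carrier G" "W = V g n" using W by auto
    have "openin \<O> W"
      using openin_continuous_map_preimage[OF continuous_map_act[OF g(1)] U(1)] by (simp add: g(2) V_def)
    moreover have "\<tau> ` carrier G \<subseteq> W"
      using g U(2) by (auto simp: V_def \<tau>_in act_\<tau> image_subset_iff)
    ultimately show ?thesis ..
  qed
  moreover have "single_valued_at h" if h: "h \<in> \<Inter> ?\<V>" for h
    unfolding single_valued_at_def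
  proof (intro ballI)
    fix g k l assume g: "g \<in> carrier G" and kl: "k \<in> fibre (act g h)" "l \<in> fibre (act g h)"
    have "act g h \<in> U n" for n
      using InterD[OF h, of "V g n"] g by (auto simp: V_def)
    then show "k = l" using U(3) kl by blast
  qed
  ultimately show ?thesis
    by (intro exI[of _ ?\<V>]) blast
qed

section \<open>Baire category on the orbit closure of a pair\<close>

text \<open>\<open>return_map\<close> brings the first point into \<open>U\<close> while fixing one
  coordinate of both points, at a level high enough to keep them in \<open>T\<close> and
  \<open>T'\<close>.\<close>

lemma orbit_meets_open:
  assumes h: "h \<in> topspace \<O>" "h' \<in> topspace \<O>"
    and U: "openin \<O> U" "\<tau> ` carrier G \<subseteq> U"
    and T: "openin \<O> T" "openin \<O> T'" and k: "k \<in> carrier G" "act k h \<in> T" "act k h' \<in> T'"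
  shows "\<exists>g\<in>carrier G. act g h \<in> T \<inter> U \<and> act g h' \<in> T'"
proof -
  obtain i where i: "\<forall>y\<in>topspace \<O>. \<forall>j\<ge>i. y j = act k h j \<longrightarrow> y \<in> T"
    using open_contains_cylinder[OF T(1) k(2)] by blast
  obtain i' where i': "\<forall>y\<in>topspace \<O>. \<forall>j\<ge>i'. y j = act k h' j \<longrightarrow> y \<in> T'"
    using open_contains_cylinder[OF T(2) k(3)] by blast
  obtain g where g: "g \<in> carrier G" "act g (act k h) \<in> U"
      "act g (act k h) (max i i') = act k h (max i i')" "act g (act k h') (max i i') = act k h' (max i i')"
    using return_map[OF act_closed[OF k(1) h(1)] act_closed[OF k(1) h(2)] U, of "max i i'"] by blast
  have "act g (act k h) \<in> T"
    using bspec[OF i, of "act g (act k h)"] g k(1) h by (metis act_closed max.cobounded1)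
  moreover have "act g (act k h') \<in> T'"
    using bspec[OF i', of "act g (act k h')"] g k(1) h by (metis act_closed max.cobounded2)
  ultimately show ?thesis
    using g k(1) h by (intro bexI[of _ "g \<otimes> k"]) (auto simp: act_mult)
qed

text \<open>On the compact Hausdorff space \<open>W\<close>, requiring the first or the second
  component to lie in a member of \<open>\<V>\<close> defines a dense open set. Countably many such
  sets have a common point.\<close>

lemma orbit_pair_single_valued:
  assumes h: "h \<in> topspace \<O>" "h' \<in> topspace \<O>"
  shows "\<exists>(a, b) \<in> prod_topology \<O> \<O> closure_of ((\<lambda>g. (act g h, act g h')) ` carrier G).
    single_valued_at a \<and> single_valued_at b"
proof -
  obtain \<V> where cV: "countable \<V>" and "\<forall>V\<in>\<V>. openin \<O> V \<and> \<tau> ` carrier G \<subseteq> V"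
    and single: "\<forall>h\<in>topspace \<O>. h \<in> \<Inter>\<V> \<longrightarrow> single_valued_at h"
    using single_valued_orbit by (elim exE conjE)
  then have \<V>: "openin \<O> V" "\<tau> ` carrier G \<subseteq> V" if "V \<in> \<V>" for V
    using that by blast+
  let ?P = "prod_topology \<O> \<O>"
  let ?orb = "(\<lambda>g. (act g h, act g h')) ` carrier G"
  define W where "W = ?P closure_of ?orb"
  let ?Z = "subtopology ?P W"
  have orb: "?orb \<subseteq> W"
    unfolding W_def by (rule closure_of_subset) (use h act_closed in auto)
  have W: "W \<subseteq> topspace ?P" by (simp only: W_def closure_of_subset_topspace)
  then have topZ: "topspace ?Z = W" by (rule topspace_subtopology_subset)
  have closedW: "closedin ?P W" by (simp add: W_def)
  have compact: "compact_space ?P" by (simp add: compact_space_prod_topology compact_space_odometer)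
  have "compact_space ?Z"
    using closedin_compact_space[OF compact closedW] by (simp add: compact_space_subtopology)
  moreover have "Hausdorff_space ?Z"
    by (intro Hausdorff_space_subtopology) (simp add: Hausdorff_space_prod_topology Hausdorff_space_odometer)
  ultimately have Z: "locally_compact_space ?Z \<and> regular_space ?Z"
    by (simp add: compact_imp_locally_compact_space compact_Hausdorff_imp_regular_space)
  define \<G> where "\<G> = (\<lambda>V. {p \<in> topspace ?Z. fst p \<in> V}) ` \<V> \<union> (\<lambda>V. {p \<in> topspace ?Z. snd p \<in> V}) ` \<V>"
  have cfst: "continuous_map ?Z \<O> fst" and csnd: "continuous_map ?Z \<O> snd"
    by (intro continuous_map_from_subtopology continuous_map_fst continuous_map_snd)+
  \<comment> \<open>Any open set meeting \<open>W\<close> contains a box around a point of the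
    orbit. The second claim is the first with \<open>h\<close> and \<open>h'\<close>
    exchanged.\<close>
  have dense: "\<exists>q\<in>W \<inter> T. q \<in> ?orb \<and> fst q \<in> V" "\<exists>q\<in>W \<inter> T. q \<in> ?orb \<and> snd q \<in> V"
    if p: "p \<in> W" and T: "openin ?P T" "p \<in> T" and V: "V \<in> \<V>" for p T V
  proof -
    obtain k where k: "k \<in> carrier G" "(act k h, act k h') \<in> T"
      using p T unfolding W_def in_closure_of by blast
    then obtain A B where AB: "openin \<O> A" "openin \<O> B" "act k h \<in> A" "act k h' \<in> B" "A \<times> B \<subseteq> T"
      using T(1) unfolding openin_prod_topology_alt by metis
    obtain g where "g \<in> carrier G" "act g h \<in> A \<inter> V" "act g h' \<in> B"
      using orbit_meets_open[OF h \<V>[OF V] AB(1,2) k(1) AB(3,4)] by blast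
    then show "\<exists>q\<in>W \<inter> T. q \<in> ?orb \<and> fst q \<in> V"
      using AB(5) orb by (intro bexI[of _ "(act g h, act g h')"]) auto
    obtain g where "g \<in> carrier G" "act g h' \<in> B \<inter> V" "act g h \<in> A"
      using orbit_meets_open[OF h(2,1) \<V>[OF V] AB(2,1) k(1) AB(4,3)] by blast
    then show "\<exists>q\<in>W \<inter> T. q \<in> ?orb \<and> snd q \<in> V"
      using AB(5) orb by (intro bexI[of _ "(act g h, act g h')"]) auto
  qed
  have "openin ?Z T \<and> ?Z closure_of T = topspace ?Z" if "T \<in> \<G>" for T
  proof
    show "openin ?Z T"
      using that \<V>(1) openin_continuous_map_preimage[OF cfst] openin_continuous_map_preimage[OF csnd]
      unfolding \<G>_def by blast
    show "?Z closure_of T = topspace ?Z"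
    proof (intro equalityI closure_of_subset_topspace subsetI)
      fix p assume p: "p \<in> topspace ?Z"
      show "p \<in> ?Z closure_of T"
        unfolding in_closure_of
      proof (intro conjI p allI impI)
        fix O' assume "p \<in> O' \<and> openin ?Z O'"
        then obtain T' where T': "openin ?P T'" "O' = T' \<inter> W" "p \<in> T'"
          unfolding openin_subtopology by blast
        show "\<exists>y. y \<in> T \<and> y \<in> O'"
          using that dense[OF _ T'(1,3)] p unfolding \<G>_def T'(2) topZ by blast
      qed
    qed
  qed
  moreover have "countable \<G>" using cV by (simp add: \<G>_def)
  ultimately have "?Z closure_of \<Inter>\<G> = topspace ?Z"
    using Baire_category[of ?Z \<G>] Z by blast
  \<comment> \<open>\<open>W\<close> is nonempty, so density of the intersection yields an actual
    point.\<close>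
  moreover have "(act \<one> h, act \<one> h') \<in> W" using orb by blast
  ultimately have "\<Inter>\<G> \<inter> topspace ?Z \<noteq> {}"
    unfolding topZ by (metis closure_of_empty closure_of_restrict empty_iff inf_commute topZ)
  then obtain a b where ab: "(a, b) \<in> \<Inter>\<G>" "(a, b) \<in> W" unfolding topZ by auto
  have "a \<in> V \<and> b \<in> V" if V: "V \<in> \<V>" for V
  proof -
    have "{p \<in> topspace ?Z. fst p \<in> V} \<in> \<G>" "{p \<in> topspace ?Z. snd p \<in> V} \<in> \<G>"
      unfolding \<G>_def using V by (rule UnI1[OF imageI], rule UnI2[OF imageI])
    then have "(a, b) \<in> {p \<in> topspace ?Z. fst p \<in> V}" "(a, b) \<in> {p \<in> topspace ?Z. snd p \<in> V}"
      using ab(1) by (meson InterD)+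
    then show ?thesis by simp
  qed
  then have "a \<in> \<Inter>\<V>" "b \<in> \<Inter>\<V>" by blast+
  moreover have "a \<in> topspace \<O>" "b \<in> topspace \<O>" using ab(2) W by auto
  ultimately show ?thesis
    using ab(2) single by (intro bexI[of _ "(a, b)"]) (simp_all add: W_def)
qed

section \<open>A function in the orbit closure determines its odometer point\<close>

text \<open>This is the projection, along the compact shift space, of a closed set of
  triples.\<close>

lemma closedin_pairs_over_common_point:
  "closedin (prod_topology \<O> \<O>) {(a, b). \<exists>x. (a, x) \<in> \<R> \<and> (b, x) \<in> \<R>}"
proof -
  let ?Q = "prod_topology (prod_topology \<O> \<O>) \<S>"
  have c: "continuous_map ?Q (prod_topology \<O> \<S>) (\<lambda>q. (fst (fst q), snd q))"
    "continuous_map ?Q (prod_topology \<O> \<S>) (\<lambda>q. (snd (fst q), snd q))"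
    using continuous_map_prod[OF continuous_map_fst[of \<O> \<O>] continuous_map_id[of \<S>]]
      continuous_map_prod[OF continuous_map_snd[of \<O> \<O>] continuous_map_id[of \<S>]] by simp_all
  have "closedin ?Q ({q \<in> topspace ?Q. (fst (fst q), snd q) \<in> \<R>} \<inter> {q \<in> topspace ?Q. (snd (fst q), snd q) \<in> \<R>})"
    by (intro closedin_Int closedin_continuous_map_preimage[OF c(1)] closedin_continuous_map_preimage[OF c(2)] closedin_\<R>)
  then have "closedin (prod_topology \<O> \<O>)
      (fst ` ({q \<in> topspace ?Q. (fst (fst q), snd q) \<in> \<R>} \<inter> {q \<in> topspace ?Q. (snd (fst q), snd q) \<in> \<R>}))"
    using Abstract_Topological_Spaces.closed_map_fst[OF compact_space_shift] unfolding closed_map_def by blast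
  moreover have "fst ` ({q \<in> topspace ?Q. (fst (fst q), snd q) \<in> \<R>} \<inter> {q \<in> topspace ?Q. (snd (fst q), snd q) \<in> \<R>})
      = {(a, b). \<exists>x. (a, x) \<in> \<R> \<and> (b, x) \<in> \<R>}"
  proof (intro equalityI subsetI)
    fix p assume "p \<in> {(a, b). \<exists>x. (a, x) \<in> \<R> \<and> (b, x) \<in> \<R>}"
    then obtain x where "(fst p, x) \<in> \<R>" "(snd p, x) \<in> \<R>" by auto
    then show "p \<in> fst ` ({q \<in> topspace ?Q. (fst (fst q), snd q) \<in> \<R>} \<inter> {q \<in> topspace ?Q. (snd (fst q), snd q) \<in> \<R>})"
      using \<R>_subset by (intro image_eqI[of _ _ "(p, x)"]) (auto simp: mem_Times_iff)
  qed auto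
  ultimately show ?thesis by simp
qed

text \<open>The complement is a union of squares of cylinders. Being distinct survives limits only
  when it is witnessed at a fixed coordinate.\<close>

lemma closedin_distinct_coord:
  "closedin (prod_topology \<O> \<O>) {p \<in> topspace (prod_topology \<O> \<O>). fst p i \<noteq> snd p i}"
proof -
  let ?C = "\<lambda>C. {h \<in> topspace \<O>. h i \<in> {C}}"
  have "openin (prod_topology \<O> \<O>) (\<Union>C. ?C C \<times> ?C C)"
  proof (rule openin_Union)
    fix S assume "S \<in> range (\<lambda>C. ?C C \<times> ?C C)"
    then obtain C where "S = ?C C \<times> ?C C" by blast
    then show "openin (prod_topology \<O> \<O>) S"
      using openin_cylinder[of i "{C}"] by (simp only: openin_prod_Times_iff) blast
  qed
  moreover have "topspace (prod_topology \<O> \<O>) - {p \<in> topspace (prod_topology \<O> \<O>). fst p i \<noteq> snd p i}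
      = (\<Union>C. ?C C \<times> ?C C)"
    by auto
  ultimately show ?thesis by (simp add: closedin_def)
qed

lemma \<R>_left_unique:
  assumes "(h, x) \<in> \<R>" "(h', x) \<in> \<R>"
  shows "h = h'"
proof (rule ccontr)
  assume "h \<noteq> h'"
  then obtain i where i: "h i \<noteq> h' i" by blast
  let ?P = "prod_topology \<O> \<O>"
  have h: "h \<in> topspace \<O>" "h' \<in> topspace \<O>" using assms \<R>_subset by auto
  obtain a b where ab: "(a, b) \<in> ?P closure_of ((\<lambda>g. (act g h, act g h')) ` carrier G)"
    and single: "single_valued_at a" "single_valued_at b"
    using orbit_pair_single_valued[OF h] by auto
  have "(\<lambda>g. (act g h, act g h')) ` carrier G \<subseteq> {(a, b). \<exists>x. (a, x) \<in> \<R> \<and> (b, x) \<in> \<R>}"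
    using \<R>_act assms by blast
  \<comment> \<open>The closed set of pairs over a common point contains the orbit of
    \<open>(h, h')\<close>, hence also the limit pair. This \<open>x\<close> need not be the
    original one.\<close>
  then obtain x where x: "(a, x) \<in> \<R>" "(b, x) \<in> \<R>"
    using closure_of_minimal[OF _ closedin_pairs_over_common_point] ab by blast
  \<comment> \<open>Left multiplication by \<open>inv g\<close> recovers coordinate
    \<open>i\<close>, so the same \<open>i\<close> separates the whole orbit.\<close>
  have "act g h i \<noteq> act g h' i" if g: "g \<in> carrier G" for g
  proof
    assume "act g h i = act g h' i"
    then have "act (inv g) (act g h) i = act (inv g) (act g h') i"
      using h g by (simp add: act_coord[OF act_closed])
    then show False using i h g by (simp add: act_inv)
  qed
  then have "(\<lambda>g. (act g h, act g h')) ` carrier G \<subseteq> {p \<in> topspace ?P. fst p i \<noteq> snd p i}"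
    using h act_closed by auto
  then have "(a, b) \<in> {p \<in> topspace ?P. fst p i \<noteq> snd p i}"
    by (rule subsetD[OF closure_of_minimal[OF _ closedin_distinct_coord] ab])
  then have "a i \<noteq> b i" by simp
  moreover have "a \<in> topspace \<O>" "b \<in> topspace \<O>" using x \<R>_subset by auto
  ultimately obtain g where g: "g \<in> carrier G" "fibre (act g a) \<noteq> fibre (act g b)"
    using no_rotation unfolding invariant_under_no_rotation_def by metis
  \<comment> \<open>Both fibres contain \<open>x g\<close> and have at most one element.\<close>
  have "fibre (act g a) = {x g}" "fibre (act g b) = {x g}"
    using \<R>_fibre[OF x(1) g(1)] \<R>_fibre[OF x(2) g(1)] single g(1)
    unfolding single_valued_at_def by blast+
  then show False using g(2) by simp
qed

section \<open>The almost one-to-one factor map onto the odometer\<close>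

lemma almost_one_one_factor_of_orbit_closure:
  "\<exists>p. almost_one_one_factor_map G (orbit_closure_space G K f) (orbit_closure_act G K f) \<O> act p \<and>
       card {x \<in> topspace (orbit_closure_space G K f). p x = odometer_base G \<Gamma>} = 1"
proof -
  let ?\<Omega> = "orbit_closure G K f" and ?Y = "orbit_closure_space G K f"
  have \<Omega>: "?\<Omega> \<subseteq> topspace \<S>" by (simp add: orbit_closure_def closure_of_subset_topspace)
  have topY: "topspace ?Y = ?\<Omega>"
    unfolding orbit_closure_space_def by (rule topspace_subtopology_subset[OF \<Omega>])
  define p where "p x = (THE h. (h, x) \<in> \<R>)" for x
  have p_eq: "p x = h" if "(h, x) \<in> \<R>" for h x
    unfolding p_def using that \<R>_left_unique by blast
  have p: "(p x, x) \<in> \<R>" if "x \<in> ?\<Omega>" for x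
    using that p_eq unfolding snd_\<R>[symmetric] by auto
  have fib: "{x \<in> topspace ?Y. p x = h} = {x. (h, x) \<in> \<R>}" for h
    using p p_eq snd_\<R> unfolding topY by force
  have "continuous_map ?Y \<O> p"
    unfolding continuous_map_closedin
  proof (intro conjI allI impI)
    show "p \<in> topspace ?Y \<rightarrow> topspace \<O>" using p \<R>_subset topY by fastforce
    fix C assume C: "closedin \<O> C"
    \<comment> \<open>Closed graph argument: the preimage of \<open>C\<close> is the projection of
      this set along the compact odometer.\<close>
    have "closedin (prod_topology \<O> \<S>) (\<R> \<inter> C \<times> topspace \<S>)"
      using C by (intro closedin_Int closedin_\<R>) (simp add: closedin_prod_Times_iff)
    then have "closedin \<S> (snd ` (\<R> \<inter> C \<times> topspace \<S>))"
      using Abstract_Topological_Spaces.closed_map_snd[OF compact_space_odometer] unfolding closed_map_def by blast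
    moreover have "snd ` (\<R> \<inter> C \<times> topspace \<S>) = {x \<in> ?\<Omega>. p x \<in> C}"
      using p p_eq \<R>_subset unfolding snd_\<R>[symmetric] by force
    ultimately show "closedin ?Y {x \<in> topspace ?Y. p x \<in> C}"
      unfolding topY unfolding orbit_closure_space_def
      by (metis (no_types, lifting) closedin_subset_topspace mem_Collect_eq subsetI)
  qed
  moreover have "p ` topspace ?Y = topspace \<O>"
  proof (intro equalityI subsetI)
    fix h assume "h \<in> topspace \<O>"
    then obtain x where x: "(h, x) \<in> \<R>" unfolding fst_\<R>[symmetric] by auto
    then have "x \<in> topspace ?Y" unfolding topY snd_\<R>[symmetric] by (rule image_eqI[rotated]) simp
    then show "h \<in> p ` topspace ?Y" using p_eq[OF x] by blast
  next
    fix h assume "h \<in> p ` topspace ?Y"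
    then show "h \<in> topspace \<O>" using p \<R>_subset topY by auto
  qed
  moreover have "p (orbit_closure_act G K f g x) = act g (p x)" if "g \<in> carrier G" "x \<in> topspace ?Y" for g x
    using p_eq[OF \<R>_act[OF p that(1)]] that by (simp add: topY orbit_closure_act_def)
  ultimately have factor: "factor_map G ?Y (orbit_closure_act G K f) \<O> act p"
    by (simp add: factor_map_def)
  obtain \<V> where cV: "countable \<V>" and "\<forall>V\<in>\<V>. openin \<O> V \<and> \<tau> ` carrier G \<subseteq> V"
    and single: "\<forall>h\<in>topspace \<O>. h \<in> \<Inter>\<V> \<longrightarrow> single_valued_at h"
    using single_valued_orbit by (elim exE conjE)
  then have \<V>: "openin \<O> V" "\<tau> ` carrier G \<subseteq> V" if "V \<in> \<V>" for V
    using that by blast+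
  \<comment> \<open>Inserting the whole space keeps the intersection inside it even if
    \<open>\<V>\<close> is empty.\<close>
  define D where "D = \<Inter> (insert (topspace \<O>) \<V>)"
  have "gdelta_in \<O> D"
    unfolding D_def by (rule gdelta_in_Inter) (use cV \<V>(1) open_imp_gdelta_in in auto)
  moreover have \<tau>D: "\<tau> ` carrier G \<subseteq> D" using \<V>(2) \<tau>_in by (auto simp: D_def)
  then have "\<O> closure_of D = topspace \<O>"
    using dense_\<tau> closure_of_mono[OF \<tau>D, of \<O>] closure_of_subset_topspace[of \<O> D] by (metis subset_antisym)
  moreover have card: "card {x \<in> topspace ?Y. p x = h} = 1" if "h \<in> D" for h
  proof -
    have h: "h \<in> topspace \<O>" "h \<in> \<Inter>\<V>" using that by (auto simp: D_def)
    obtain x where x: "(h, x) \<in> \<R>" using h(1) fst_\<R> by force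
    \<comment> \<open>At each \<open>g\<close>, both values lie in the fibre over
      \<open>act g h\<close>, which has at most one element.\<close>
    have xy: "y = x" if y: "(h, y) \<in> \<R>" for y
    proof (rule extensionalityI[of _ "carrier G"])
      show "x \<in> extensional (carrier G)" "y \<in> extensional (carrier G)"
        using x y \<R>_subset by (auto simp: topspace_full_shift PiE_def)
      show "y g = x g" if "g \<in> carrier G" for g
        using \<R>_fibre[OF x that] \<R>_fibre[OF y that] single h that
        unfolding single_valued_at_def by blast
    qed
    have "{y. (h, y) \<in> \<R>} = {x}"
    proof (intro equalityI subsetI)
      show "y \<in> {x}" if "y \<in> {y. (h, y) \<in> \<R>}" for y using xy[of y] that by simp
    qed (use x in simp)
    then show ?thesis by (simp add: fib)
  qed
  moreover have "D \<subseteq> {h \<in> topspace \<O>. card {x \<in> topspace ?Y. p x = h} = 1}"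
    using card by (auto simp: D_def)
  ultimately have "almost_one_one_factor_map G ?Y (orbit_closure_act G K f) \<O> act p"
    unfolding almost_one_one_factor_map_def using factor by blast
  moreover have "odometer_base G \<Gamma> \<in> D" using \<tau>D \<tau>_one by force
  ultimately show ?thesis using card by blast
qed

end

lemma (in subodometer) almost_one_one_factor_of_conjugate:
  fixes K :: "'k topology"
  assumes "countable (carrier G)" "compact_space K" "metrizable_space K"
    and "semicocycle G \<Gamma> K f" "invariant_under_no_rotation G \<Gamma> K f"
    and conj: "conjugate_systems G X \<phi> (orbit_closure_space G K f) (orbit_closure_act G K f)"
  shows "\<exists>p. almost_one_one_factor_map G X \<phi> \<O> act p \<and>
             card {x \<in> topspace X. p x = odometer_base G \<Gamma>} = 1"
proof -
  interpret semicocycle_shift G \<Gamma> K f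
    using assms by unfold_locales
  obtain p where p: "almost_one_one_factor_map G (orbit_closure_space G K f) (orbit_closure_act G K f) \<O> act p"
    "card {x \<in> topspace (orbit_closure_space G K f). p x = odometer_base G \<Gamma>} = 1"
    using almost_one_one_factor_of_orbit_closure by (elim exE conjE)
  obtain c where c: "factor_map G X \<phi> (orbit_closure_space G K f) (orbit_closure_act G K f) c"
    "bij_betw c (topspace X) (topspace (orbit_closure_space G K f))"
    using conj unfolding conjugate_systems_def by (elim exE conjE)
  have "card {x \<in> topspace X. (p \<circ> c) x = odometer_base G \<Gamma>} = 1"
    using card_vimage_bij_betw[OF c(2), of "\<lambda>y. p y = odometer_base G \<Gamma>"] p(2) by simp
  with almost_one_one_factor_map_conjugate[OF c p(1)] show ?thesis by (intro exI conjI)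
qed


section \<open>The semicocycle of a point with trivial fibre\<close>

context subodometer
begin

context
  fixes X :: "'x topology" and \<phi> :: "'a \<Rightarrow> 'x \<Rightarrow> 'x" and p :: "'x \<Rightarrow> nat \<Rightarrow> 'a set" and x\<^sub>0 :: 'x
  assumes minimal: "minimal_system G X \<phi>"
    and factor: "factor_map G X \<phi> (odometer G \<Gamma>) (odometer_act G \<Gamma>) p"
    and base_fibre: "{x \<in> topspace X. p x = odometer_base G \<Gamma>} = {x\<^sub>0}"
begin

lemma compact_X: "compact_space X" and metrizable_X: "metrizable_space X"
  and action: "group_action G (topspace X) \<phi>"
  and homeo: "g \<in> carrier G \<Longrightarrow> homeomorphic_map X X (\<phi> g)"
  using minimal by (auto simp: minimal_system_def dynamical_system_def)

lemma continuous_p: "continuous_map X \<O> p" and image_p: "p ` topspace X = topspace \<O>"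
  and p_act: "g \<in> carrier G \<Longrightarrow> x \<in> topspace X \<Longrightarrow> p (\<phi> g x) = act g (p x)"
  using factor by (auto simp: factor_map_def)

lemma x\<^sub>0_in: "x\<^sub>0 \<in> topspace X" and p_x\<^sub>0: "p x\<^sub>0 = odometer_base G \<Gamma>"
  using base_fibre by blast+

lemma \<phi>_closed: "g \<in> carrier G \<Longrightarrow> x \<in> topspace X \<Longrightarrow> \<phi> g x \<in> topspace X"
  using group_action.element_image[OF action] by blast

lemma \<phi>_mult: "g \<in> carrier G \<Longrightarrow> k \<in> carrier G \<Longrightarrow> x \<in> topspace X \<Longrightarrow> \<phi> (g \<otimes> k) x = \<phi> g (\<phi> k x)"
  using group_action.composition_rule[OF action] by blast

lemma \<phi>_one: "x \<in> topspace X \<Longrightarrow> \<phi> \<one> x = x"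
  using group_action.id_eq_one[OF action] by (metis restrict_apply')

lemma p_orbit: "g \<in> carrier G \<Longrightarrow> p (\<phi> g x\<^sub>0) = \<tau> g"
  by (simp add: p_act x\<^sub>0_in p_x\<^sub>0 odometer_embed_def)

text \<open>Translation by \<open>inv g\<close> moves the fibre over \<open>\<tau> g\<close> into
  the fibre over the base point, which is trivial.\<close>

lemma \<tau>_fibre:
  assumes g: "g \<in> carrier G" and x: "x \<in> topspace X" "p x = \<tau> g"
  shows "x = \<phi> g x\<^sub>0"
proof -
  have "p (\<phi> (inv g) x) = odometer_base G \<Gamma>"
    using g x by (simp add: p_act odometer_embed_def act_inv base_in)
  then have "\<phi> (inv g) x = x\<^sub>0"
    using base_fibre \<phi>_closed g x(1) by blast
  moreover have "\<phi> g (\<phi> (inv g) x) = x"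
    using \<phi>_mult[of g "inv g" x] g x(1) by (simp add: \<phi>_one)
  ultimately show ?thesis by simp
qed

lemma dense_orbit: "X closure_of ((\<lambda>g. \<phi> g x\<^sub>0) ` carrier G) = topspace X"
proof -
  have "orbit G \<phi> x\<^sub>0 = (\<lambda>g. \<phi> g x\<^sub>0) ` carrier G"
    unfolding orbit_def by blast
  moreover have "X closure_of (orbit G \<phi> x\<^sub>0) = topspace X"
    using minimal x\<^sub>0_in unfolding minimal_system_def by blast
  ultimately show ?thesis by simp
qed

text \<open>The fibre of \<open>p\<close> over \<open>\<tau> g\<close> is one point, so it lies in
  \<open>V\<close> exactly when \<open>\<tau> g\<close> avoids the image of the complement of
  \<open>V\<close>. That image is closed, since \<open>p\<close> maps a compact space to a Hausdorff
  one.\<close>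

lemma semicocycle_orbit: "semicocycle G \<Gamma> X (\<lambda>g\<in>carrier G. \<phi> g x\<^sub>0)"
proof -
  let ?P = "pullback_topology (carrier G) \<tau> \<O>" and ?f = "\<lambda>g\<in>carrier G. \<phi> g x\<^sub>0"
  have top: "topspace ?P = carrier G"
    using \<tau>_in by (auto simp: topspace_pullback_topology)
  have "openin ?P {g \<in> topspace ?P. ?f g \<in> V}" if V: "openin X V" for V
  proof -
    let ?T = "topspace \<O> - p ` (topspace X - V)"
    have "closed_map X \<O> p"
      by (rule continuous_imp_closed_map[OF continuous_p compact_X Hausdorff_space_odometer])
    then have "closedin \<O> (p ` (topspace X - V))"
      using V unfolding closed_map_def by blast
    then have "openin \<O> ?T" by blast
    moreover have "{g \<in> topspace ?P. ?f g \<in> V} = \<tau> -` ?T \<inter> carrier G"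
    proof (intro equalityI subsetI)
      fix g assume "g \<in> {g \<in> topspace ?P. ?f g \<in> V}"
      then have g: "g \<in> carrier G" "\<phi> g x\<^sub>0 \<in> V" by (auto simp: top)
      have "\<tau> g \<notin> p ` (topspace X - V)"
      proof
        assume "\<tau> g \<in> p ` (topspace X - V)"
        then obtain x where "p x = \<tau> g" "x \<in> topspace X" "x \<notin> V" by (elim imageE DiffE) simp
        then show False using \<tau>_fibre[OF g(1)] g(2) by simp
      qed
      then show "g \<in> \<tau> -` ?T \<inter> carrier G" using g(1) \<tau>_in by simp
    next
      fix g assume "g \<in> \<tau> -` ?T \<inter> carrier G"
      then have g: "g \<in> carrier G" "\<tau> g \<notin> p ` (topspace X - V)" by auto
      have "\<phi> g x\<^sub>0 \<in> V"
      proof (rule ccontr)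
        assume "\<phi> g x\<^sub>0 \<notin> V"
        then have "p (\<phi> g x\<^sub>0) \<in> p ` (topspace X - V)"
          using \<phi>_closed[OF g(1) x\<^sub>0_in] by (intro imageI DiffI)
        then show False using g p_orbit by simp
      qed
      then show "g \<in> {g \<in> topspace ?P. ?f g \<in> V}" using g(1) by (simp add: top)
    qed
    ultimately show ?thesis unfolding openin_pullback_topology by metis
  qed
  moreover have "?f \<in> topspace ?P \<rightarrow> topspace X"
    unfolding top using \<phi>_closed x\<^sub>0_in by simp
  ultimately show ?thesis by (simp add: semicocycle_def continuous_map_def)
qed

text \<open>The graph closure is \<open>{(p x, x)}\<close>: this set is closed and contains the
  generators, and it is the continuous image of a space with a dense orbit that maps onto
  them.\<close>

lemma fibre_orbit:
  assumes h: "h \<in> topspace \<O>"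
  shows "semicocycle_fibre G \<Gamma> X (\<lambda>g\<in>carrier G. \<phi> g x\<^sub>0) h = {x \<in> topspace X. p x = h}"
proof -
  let ?P = "prod_topology \<O> X"
  let ?F = "(\<lambda>g. (\<tau> g, \<phi> g x\<^sub>0)) ` carrier G"
  have F: "(\<lambda>g. (\<tau> g, (\<lambda>g\<in>carrier G. \<phi> g x\<^sub>0) g)) ` carrier G = ?F"
    by (rule image_cong) simp_all
  have "closedin ?P {q \<in> topspace ?P. fst q = (p \<circ> snd) q}"
    by (rule closedin_continuous_maps_eq[OF Hausdorff_space_odometer continuous_map_fst
          continuous_map_compose[OF continuous_map_snd continuous_p]])
  moreover have "?F \<subseteq> {q \<in> topspace ?P. fst q = (p \<circ> snd) q}"
    using p_orbit \<tau>_in \<phi>_closed x\<^sub>0_in by auto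
  ultimately have "?P closure_of ?F \<subseteq> {q \<in> topspace ?P. fst q = (p \<circ> snd) q}"
    by (intro closure_of_minimal)
  then have "p x = h" if "(h, x) \<in> ?P closure_of ?F" for x
    using that by fastforce
  moreover have "(p x, x) \<in> ?P closure_of ?F" if x: "x \<in> topspace X" for x
  proof -
    have "continuous_map X ?P (\<lambda>x. (p x, x))"
      using continuous_p continuous_map_id[of X] by (simp add: continuous_map_pairwise o_def id_def)
    then have "(\<lambda>x. (p x, x)) ` topspace X \<subseteq> ?P closure_of ((\<lambda>x. (p x, x)) ` (\<lambda>g. \<phi> g x\<^sub>0) ` carrier G)"
      unfolding dense_orbit[symmetric] by (rule continuous_map_image_closure_subset)
    moreover have "(\<lambda>x. (p x, x)) ` (\<lambda>g. \<phi> g x\<^sub>0) ` carrier G = ?F"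
      unfolding image_image by (rule image_cong) (simp_all add: p_orbit)
    ultimately show ?thesis using x by auto
  qed
  ultimately show ?thesis
    unfolding semicocycle_fibre_def semicocycle_graph_def F by blast
qed

text \<open>Fibres of \<open>p\<close> over distinct points are disjoint and nonempty, so the
  neutral element already tells them apart.\<close>

lemma no_rotation_orbit: "invariant_under_no_rotation G \<Gamma> X (\<lambda>g\<in>carrier G. \<phi> g x\<^sub>0)"
  unfolding invariant_under_no_rotation_def
proof (intro ballI impI bexI[OF _ one_closed])
  fix h h' assume h: "h \<in> topspace \<O>" "h' \<in> topspace \<O>" "h \<noteq> h'"
  obtain x where "x \<in> topspace X" "p x = h" using h(1) unfolding image_p[symmetric] by blast
  then show "semicocycle_fibre G \<Gamma> X (\<lambda>g\<in>carrier G. \<phi> g x\<^sub>0) (act \<one> h)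
      \<noteq> semicocycle_fibre G \<Gamma> X (\<lambda>g\<in>carrier G. \<phi> g x\<^sub>0) (act \<one> h')"
    using h by (auto simp: act_one fibre_orbit)
qed

text \<open>The conjugacy \<open>c\<close> sends a point to its orbit map; evaluation at
  \<open>\<one>\<close> recovers the point. Right translation in the shift makes \<open>c\<close>
  equivariant, as \<open>\<phi> g (\<phi> \<gamma> x) = \<phi> (g \<otimes> \<gamma>)
  x\<close>.\<close>

lemma conjugate_orbit_closure:
  "conjugate_systems G X \<phi> (orbit_closure_space G X (\<lambda>g\<in>carrier G. \<phi> g x\<^sub>0))
     (orbit_closure_act G X (\<lambda>g\<in>carrier G. \<phi> g x\<^sub>0))"
proof -
  let ?f = "\<lambda>g\<in>carrier G. \<phi> g x\<^sub>0" and ?S = "full_shift G X"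
  define c where "c x = (\<lambda>g\<in>carrier G. \<phi> g x)" for x
  have c_in: "c x \<in> topspace ?S" if "x \<in> topspace X" for x
    using that \<phi>_closed by (auto simp: c_def topspace_full_shift)
  have c_act: "c (\<phi> \<gamma> x) = shift_act G X \<gamma> (c x)" if "\<gamma> \<in> carrier G" "x \<in> topspace X" for \<gamma> x
    using that c_in[OF that(2)] by (auto simp: c_def shift_act_def \<phi>_mult)
  have cont: "continuous_map X ?S c"
    unfolding full_shift_def continuous_map_componentwise
  proof (intro conjI ballI)
    show "continuous_map X X (\<lambda>x. c x g)" if "g \<in> carrier G" for g
      using homeomorphic_imp_continuous_map[OF homeo[OF that]] that by (simp add: c_def)
  qed (auto simp: c_def)
  have orb: "c ` (\<lambda>g. \<phi> g x\<^sub>0) ` carrier G = orbit G (shift_act G X) ?f"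
  proof -
    have "c x\<^sub>0 = ?f" by (simp add: c_def)
    then have "c ` (\<lambda>g. \<phi> g x\<^sub>0) ` carrier G = (\<lambda>g. shift_act G X g ?f) ` carrier G"
      unfolding image_image by (intro image_cong refl) (simp add: c_act x\<^sub>0_in)
    then show ?thesis unfolding orbit_def by blast
  qed
  have image: "c ` topspace X = orbit_closure G X ?f"
  proof
    show "c ` topspace X \<subseteq> orbit_closure G X ?f"
      using continuous_map_image_closure_subset[OF cont, of "(\<lambda>g. \<phi> g x\<^sub>0) ` carrier G"]
      by (simp add: dense_orbit orb orbit_closure_def)
    have "Hausdorff_space ?S"
      by (simp add: full_shift_def Hausdorff_space_product_topology metrizable_imp_Hausdorff_space metrizable_X)
    \<comment> \<open>A closed image containing the orbit of \<open>?f\<close> contains its closure;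
      the reverse inclusion came from density of the orbit in \<open>X\<close>.\<close>
    then have "closedin ?S (c ` topspace X)"
      using continuous_imp_closed_map[OF cont compact_X] unfolding closed_map_def by blast
    moreover have "c ` (\<lambda>g. \<phi> g x\<^sub>0) ` carrier G \<subseteq> c ` topspace X"
      using \<phi>_closed x\<^sub>0_in by (intro image_mono) blast
    ultimately show "orbit_closure G X ?f \<subseteq> c ` topspace X"
      unfolding orbit_closure_def orb by (intro closure_of_minimal)
  qed
  have top: "topspace (orbit_closure_space G X ?f) = orbit_closure G X ?f"
    unfolding orbit_closure_space_def
    by (rule topspace_subtopology_subset) (simp add: orbit_closure_def closure_of_subset_topspace)
  have "factor_map G X \<phi> (orbit_closure_space G X ?f) (orbit_closure_act G X ?f) c"
    unfolding factor_map_def top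
  proof (intro conjI ballI)
    show "continuous_map X (orbit_closure_space G X ?f) c"
      unfolding orbit_closure_space_def continuous_map_in_subtopology using cont image by blast
    show "c (\<phi> g x) = orbit_closure_act G X ?f g (c x)" if "g \<in> carrier G" "x \<in> topspace X" for g x
    proof -
      have "c x \<in> orbit_closure G X ?f" using that(2) image by blast
      then show ?thesis by (simp add: orbit_closure_act_def c_act that)
    qed
  qed (rule image)
  moreover have "inj_on c (topspace X)"
  proof (rule inj_onI)
    fix x y assume xy: "x \<in> topspace X" "y \<in> topspace X" "c x = c y"
    have "c z \<one> = z" if "z \<in> topspace X" for z
      using that by (simp add: c_def \<phi>_one)
    then show "x = y" using xy by metis
  qed
  ultimately show ?thesis
    unfolding conjugate_systems_def bij_betw_def top using image by blast
qed

end

end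


text \<open>A formula cannot quantify over the type carrying \<open>K\<close>. The forward direction
  produces \<open>K = X\<close>, so the equivalence is stated for value spaces on \<open>'x\<close>;
  the second conjunct gives the converse for value spaces on any type.\<close>

theorem theorem4:
  fixes G :: "('g, 'm) monoid_scheme"
    and X :: "'x topology" and \<phi> :: "'g \<Rightarrow> 'x \<Rightarrow> 'x"
    and \<Gamma> :: "nat \<Rightarrow> 'g set"
  assumes "group G"
    and "finitely_generated_group G"
    and "residually_finite_group G"
    and "minimal_system G X \<phi>"
    and "finite_index_chain G \<Gamma>"
    and "(\<Inter>i. \<Gamma> i) = {\<one>\<^bsub>G\<^esub>}"
  shows "((\<exists>p. almost_one_one_factor_map G X \<phi> (odometer G \<Gamma>) (odometer_act G \<Gamma>) p \<and>
               card {x \<in> topspace X. p x = odometer_base G \<Gamma>} = 1)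
          \<longleftrightarrow>
          (\<exists>(K :: 'x topology) f.
               compact_space K \<and> metrizable_space K \<and>
               semicocycle G \<Gamma> K f \<and> invariant_under_no_rotation G \<Gamma> K f \<and>
               conjugate_systems G X \<phi> (orbit_closure_space G K f) (orbit_closure_act G K f)))
       \<and> (\<forall>(K :: 'k topology) f.
               compact_space K \<and> metrizable_space K \<and>
               semicocycle G \<Gamma> K f \<and> invariant_under_no_rotation G \<Gamma> K f \<and>
               conjugate_systems G X \<phi> (orbit_closure_space G K f) (orbit_closure_act G K f)
          \<longrightarrow>
          (\<exists>p. almost_one_one_factor_map G X \<phi> (odometer G \<Gamma>) (odometer_act G \<Gamma>) p \<and>
               card {x \<in> topspace X. p x = odometer_base G \<Gamma>} = 1))"
proof -
  interpret subodometer G \<Gamma>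
    using assms(1,5) by (simp add: subodometer_def subodometer_axioms_def)
  have countable: "countable (carrier G)"
    using assms(2) countable_generate unfolding finitely_generated_group_def
    by (metis countable_finite)
  have "\<exists>(K :: 'x topology) f. compact_space K \<and> metrizable_space K \<and>
          semicocycle G \<Gamma> K f \<and> invariant_under_no_rotation G \<Gamma> K f \<and>
          conjugate_systems G X \<phi> (orbit_closure_space G K f) (orbit_closure_act G K f)"
    if p: "almost_one_one_factor_map G X \<phi> \<O> act p" "card {x \<in> topspace X. p x = odometer_base G \<Gamma>} = 1" for p
  proof -
    obtain x\<^sub>0 where x\<^sub>0: "{x \<in> topspace X. p x = odometer_base G \<Gamma>} = {x\<^sub>0}"
      using p(2) by (rule card_1_singletonE)
    have factor: "factor_map G X \<phi> \<O> act p"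
      using p(1) by (simp add: almost_one_one_factor_map_def)
    have "compact_space X" "metrizable_space X"
      using assms(4) by (simp_all add: minimal_system_def dynamical_system_def)
    then show ?thesis
      using semicocycle_orbit[OF assms(4) factor x\<^sub>0] no_rotation_orbit[OF assms(4) factor x\<^sub>0]
        conjugate_orbit_closure[OF assms(4) factor x\<^sub>0]
      by (intro exI conjI)
  qed
  \<comment> \<open>Polymorphic in the type of values, this fact serves both at \<open>'x\<close>
    and at \<open>'k\<close>.\<close>
  moreover note almost_one_one_factor_of_conjugate[OF countable]
  ultimately show ?thesis
    by (intro conjI iffI allI impI; elim exE conjE) blast+
qed

end
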